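(* Let $\mu_0=\sum_{i=1}^{N_0}a_i\delta_{x^{(i)}}\in\mathcal P(\mathbb R^{d_0})$ and $\mu_1=\sum_{j=1}^{N_1}b_j\delta_{y^{(j)}}\in\mathcal P(\mathbb R^{d_1})$ be finitely supported with distinct atoms and positive weights, let $\varepsilon>0$, $A\in\mathbb R^{d_0\times d_1}$, and let $\mathbf\Pi^A\in\mathbb R^{N_0\times N_1}$ be the matrix of the unique optimal coupling of $\mathrm{OT}_{A,\varepsilon}(\mu_0,\mu_1)$. Fix $\delta>0$. Then, for a suitable choice of its parameters $\gamma$ and $k_{\max}$, Sinkhorn's algorithm (described in the context, with cost $c=c_A$) returns an $(e^\delta-1)$-oracle approximation $\widetilde{\mathbf\Pi}^A$ of $\mathbf\Pi^A$ (i.e. $\|\widetilde{\mathbf\Pi}^A-\mathbf\Pi^A\|_\infty<e^\delta-1$) in at most $\max\{1,\lceil\tilde k\rceil\}$ iterations, where $\tilde k$ depends only on $\mu_0,\mu_1,A,\delta,\varepsilon$ and is given by \[\tilde k=\min\left\{1+\frac{1}{2\log(\lambda(K))}\log\left(\frac{\delta(1-\lambda(K))}{\mathsf d_H((\mathbf\Pi^1)^{\intercal}\mathbf 1_{N_0},b)}\right),\ 1-\frac{4\underline b^{-1}}{\delta(1-\lambda(K))+2-\sqrt{\delta^2(1-\lambda(K))^2+4}}\log\left(e^{-\|C\|_\infty/\varepsilon}\min_{1\le i\le N_0,\,1\le j\le N_1}a_i\wedge b_j\right)\right\}.\]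
   Context: For $A\in\mathbb R^{d_0\times d_1}$, $c_A(x,y)=-4\|x\|^2\|y\|^2-32x^{\intercal}Ay$ and $\mathrm{OT}_{A,\varepsilon}(\mu_0,\mu_1)=\inf_{\pi\in\Pi(\mu_0,\mu_1)}\int c_A\,d\pi+\varepsilon\,\mathsf D_{\mathsf{KL}}(\pi\|\mu_0\otimes\mu_1)$, with $\Pi(\mu_0,\mu_1)$ the set of couplings; $\mathbf\Pi^A_{ij}=\pi^A(\{(x^{(i)},y^{(j)})\})$ for the unique optimal $\pi^A$. $\|\cdot\|_\infty$ is the entrywise maximum of absolute values; $a\wedge b=\min\{a,b\}$; $\mathbf 1_n$ is the all-ones vector. A $\delta$-oracle approximation of $\mathbf\Pi^A$ is a matrix $\widetilde{\mathbf\Pi}^A$ with $\|\widetilde{\mathbf\Pi}^A-\mathbf\Pi^A\|_\infty<\delta$. $C_{ij}=c_A(x^{(i)},y^{(j)})$, $K_{ij}=e^{-C_{ij}/\varepsilon}$, $\underline b=\min_{1\le j\le N_1}b_j$. Sinkhorn's algorithm (vector divisions are componentwise): fix a threshold $\gamma$ and a maximum iteration number $k_{\max}$; set $u_0=\mathbf 1_{N_0}/N_0$; for $k=1,2,\dots$ set $v_k=b/(K^{\intercal}u_{k-1})$, $u_k=a/(Kv_k)$, $\mathbf\Pi^k=\mathrm{diag}(u_k)K\,\mathrm{diag}(v_k)$; stop as soon as $\|(\mathbf\Pi^k)^{\intercal}\mathbf 1_{N_0}-b\|_2<\gamma$ or the iteration limit $k_{\max}$ is reached, and return $\mathbf\Pi^k$.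 For vectors $x,y$ with positive entries, $\mathsf d_H(x,y)=\log\max_{i,j}\frac{x_iy_j}{y_ix_j}$ (Hilbert's projective metric). For a matrix $K$ with positive entries, $\eta(K)=\max_{i,j,k,l}\frac{K_{ik}K_{jl}}{K_{jk}K_{il}}$ and $\lambda(K)=\frac{\sqrt{\eta(K)}-1}{\sqrt{\eta(K)}+1}\in[0,1)$. When $\mathsf d_H((\mathbf\Pi^1)^{\intercal}\mathbf 1_{N_0},b)=0$ (in particular when $\lambda(K)=0$) the first term in the minimum is read as $1$. *)

theory Defs
  imports "HOL-Probability.Information"
begin

section \<open>Entropic optimal transport\<close>

text \<open>The measure \<open>\<Sum>\<^sub>i a\<^sub>i \<delta>\<^bsub>x i\<^esub>\<close> on the Borel sets.\<close>

definition weighted_diracs :: "real ^ 'n \<Rightarrow> ('n::finite \<Rightarrow> 'b::topological_space) \<Rightarrow> 'b measure" where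
  "weighted_diracs a x = distr (point_measure UNIV (\<lambda>i. ennreal (a $ i))) borel x"

lemma emeasure_weighted_diracs:
  assumes "S \<in> sets borel"
  shows "emeasure (weighted_diracs a x) S = (\<Sum>i\<in>UNIV. ennreal (a $ i) * indicator S (x i))"
proof -
  have "x \<in> measurable (point_measure UNIV (\<lambda>i. ennreal (a $ i))) borel"
    by (simp add: measurable_point_measure_eq1)
  then have "emeasure (weighted_diracs a x) S = emeasure (point_measure UNIV (\<lambda>i. ennreal (a $ i))) (x -` S)"
    unfolding weighted_diracs_def using assms
    by (subst emeasure_distr) (auto simp: space_point_measure)
  also have "\<dots> = (\<Sum>i | i \<in> x -` S. ennreal (a $ i))"
    by (subst emeasure_point_measure_finite) (auto simp: vimage_def)
  also have "\<dots> = (\<Sum>i\<in>UNIV. ennreal (a $ i) * indicator S (x i))"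
    by (rule sum.mono_neutral_cong_left) (auto simp: indicator_def)
  finally show ?thesis .
qed

definition couplings :: "'a::topological_space measure \<Rightarrow> 'b::topological_space measure \<Rightarrow> ('a \<times> 'b) measure set" where
  "couplings \<mu> \<nu> = {\<pi>. sets \<pi> = sets (borel \<Otimes>\<^sub>M borel) \<and> distr \<pi> borel fst = \<mu> \<and> distr \<pi> borel snd = \<nu>}"

text \<open>
  \<open>D\<^sub>K\<^sub>L(\<pi> \<parallel> \<rho>)\<close> with its value \<open>\<infinity>\<close>, for probability measures. The library's
  \<^const>\<open>KL_divergence\<close> is real-valued and takes the reference measure first.
\<close>

definition rel_entropy :: "'a measure \<Rightarrow> 'a measure \<Rightarrow> ereal" where
  "rel_entropy \<pi> \<rho> =
     (if absolutely_continuous \<rho> \<pi> \<and> integrable \<pi> (entropy_density (exp 1) \<rho> \<pi>)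
      then ereal (KL_divergence (exp 1) \<rho> \<pi>) else \<infinity>)"

definition eot_objective ::
  "('a \<times> 'b \<Rightarrow> real) \<Rightarrow> real \<Rightarrow> 'a measure \<Rightarrow> 'b measure \<Rightarrow> ('a \<times> 'b) measure \<Rightarrow> ereal" where
  "eot_objective c \<epsilon> \<mu> \<nu> \<pi> = ereal (\<integral>z. c z \<partial>\<pi>) + ereal \<epsilon> * rel_entropy \<pi> (\<mu> \<Otimes>\<^sub>M \<nu>)"

definition eot_value ::
  "('a::topological_space \<times> 'b::topological_space \<Rightarrow> real) \<Rightarrow> real \<Rightarrow> 'a measure \<Rightarrow> 'b measure \<Rightarrow> ereal" where
  "eot_value c \<epsilon> \<mu> \<nu> = (INF \<pi>\<in>couplings \<mu> \<nu>. eot_objective c \<epsilon> \<mu> \<nu> \<pi>)"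

definition eot_optimal ::
  "('a::topological_space \<times> 'b::topological_space \<Rightarrow> real) \<Rightarrow> real \<Rightarrow> 'a measure \<Rightarrow> 'b measure
     \<Rightarrow> ('a \<times> 'b) measure \<Rightarrow> bool" where
  "eot_optimal c \<epsilon> \<mu> \<nu> \<pi> \<longleftrightarrow>
     \<pi> \<in> couplings \<mu> \<nu> \<and> eot_objective c \<epsilon> \<mu> \<nu> \<pi> = eot_value c \<epsilon> \<mu> \<nu>"

definition eot_plan ::
  "('a::topological_space \<times> 'b::topological_space \<Rightarrow> real) \<Rightarrow> real \<Rightarrow> 'a measure \<Rightarrow> 'b measure
     \<Rightarrow> ('a \<times> 'b) measure" where
  "eot_plan c \<epsilon> \<mu> \<nu> = (THE \<pi>. eot_optimal c \<epsilon> \<mu> \<nu> \<pi>)"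

definition cost_A :: "real ^ 'd1 ^ 'd0 \<Rightarrow> (real ^ 'd0) \<times> (real ^ 'd1) \<Rightarrow> real" where
  "cost_A A = (\<lambda>(x, y). - 4 * (norm x)\<^sup>2 * (norm y)\<^sup>2 - 32 * (x \<bullet> (A *v y)))"

definition plan_matrix ::
  "('n0 \<Rightarrow> 'a) \<Rightarrow> ('n1 \<Rightarrow> 'b) \<Rightarrow> ('a \<times> 'b) measure \<Rightarrow> real ^ 'n1 ^ 'n0" where
  "plan_matrix x y \<pi> = (\<chi> i j. measure \<pi> {(x i, y j)})"

definition cost_matrix ::
  "('a \<times> 'b \<Rightarrow> real) \<Rightarrow> ('n0 \<Rightarrow> 'a) \<Rightarrow> ('n1 \<Rightarrow> 'b) \<Rightarrow> real ^ 'n1 ^ 'n0" where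
  "cost_matrix c x y = (\<chi> i j. c (x i, y j))"


section \<open>Sinkhorn's algorithm\<close>

definition entry_max_norm :: "real ^ 'n ^ 'm \<Rightarrow> real" where
  "entry_max_norm M = Max (range (\<lambda>(i, j). \<bar>M $ i $ j\<bar>))"

definition oracle_approximation :: "real \<Rightarrow> real ^ 'n ^ 'm \<Rightarrow> real ^ 'n ^ 'm \<Rightarrow> bool" where
  "oracle_approximation \<delta> P Q \<longleftrightarrow> entry_max_norm (Q - P) < \<delta>"

definition gibbs_kernel :: "real \<Rightarrow> real ^ 'n ^ 'm \<Rightarrow> real ^ 'n ^ 'm" where
  "gibbs_kernel \<epsilon> C = (\<chi> i j. exp (- (C $ i $ j) / \<epsilon>))"

definition vec_divide :: "real ^ 'n \<Rightarrow> real ^ 'n \<Rightarrow> real ^ 'n" (infixl "\<oslash>" 70) where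
  "p \<oslash> q = (\<chi> i. p $ i / q $ i)"

definition diag_matrix :: "real ^ 'n \<Rightarrow> real ^ 'n ^ 'n" where
  "diag_matrix w = (\<chi> i j. if i = j then w $ i else 0)"

primrec sinkhorn_u :: "real ^ 'm \<Rightarrow> real ^ 'n \<Rightarrow> real ^ 'n ^ 'm \<Rightarrow> nat \<Rightarrow> real ^ 'm" where
  "sinkhorn_u a b K 0 = (\<chi> i. 1 / real CARD('m))"
| "sinkhorn_u a b K (Suc k) = a \<oslash> (K *v (b \<oslash> (transpose K *v sinkhorn_u a b K k)))"

text \<open>The following two are meant for \<open>k \<ge> 1\<close> only.\<close>

definition sinkhorn_v :: "real ^ 'm \<Rightarrow> real ^ 'n \<Rightarrow> real ^ 'n ^ 'm \<Rightarrow> nat \<Rightarrow> real ^ 'n" where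
  "sinkhorn_v a b K k = b \<oslash> (transpose K *v sinkhorn_u a b K (k - 1))"

definition sinkhorn_matrix :: "real ^ 'm \<Rightarrow> real ^ 'n \<Rightarrow> real ^ 'n ^ 'm \<Rightarrow> nat \<Rightarrow> real ^ 'n ^ 'm" where
  "sinkhorn_matrix a b K k =
     diag_matrix (sinkhorn_u a b K k) ** K ** diag_matrix (sinkhorn_v a b K k)"

definition column_sums :: "real ^ 'n ^ 'm \<Rightarrow> real ^ 'n" where
  "column_sums P = transpose P *v (\<chi> i. 1)"

text \<open>The index \<open>k \<ge> 1\<close> of the iteration at which the loop stops.\<close>

definition sinkhorn_iterations ::
  "real ^ 'm \<Rightarrow> real ^ 'n \<Rightarrow> real ^ 'n ^ 'm \<Rightarrow> real \<Rightarrow> nat \<Rightarrow> nat" where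
  "sinkhorn_iterations a b K \<gamma> k_max =
     (LEAST k. 1 \<le> k \<and> (norm (column_sums (sinkhorn_matrix a b K k) - b) < \<gamma> \<or> k_max \<le> k))"

definition sinkhorn_output ::
  "real ^ 'm \<Rightarrow> real ^ 'n \<Rightarrow> real ^ 'n ^ 'm \<Rightarrow> real \<Rightarrow> nat \<Rightarrow> real ^ 'n ^ 'm" where
  "sinkhorn_output a b K \<gamma> k_max = sinkhorn_matrix a b K (sinkhorn_iterations a b K \<gamma> k_max)"

definition hilbert_dist :: "real ^ 'n \<Rightarrow> real ^ 'n \<Rightarrow> real" where
  "hilbert_dist p q = ln (Max (range (\<lambda>(i, j). (p $ i * q $ j) / (q $ i * p $ j))))"

definition kernel_eta :: "real ^ 'n ^ 'm \<Rightarrow> real" where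
  "kernel_eta K = Max (range (\<lambda>(i, j, k, l). (K $ i $ k * K $ j $ l) / (K $ j $ k * K $ i $ l)))"

definition kernel_lambda :: "real ^ 'n ^ 'm \<Rightarrow> real" where
  "kernel_lambda K = (sqrt (kernel_eta K) - 1) / (sqrt (kernel_eta K) + 1)"

definition k_tilde_contraction ::
  "real ^ 'm \<Rightarrow> real ^ 'n \<Rightarrow> real ^ 'n ^ 'm \<Rightarrow> real \<Rightarrow> real" where
  "k_tilde_contraction a b K \<delta> =
     (let \<Delta> = hilbert_dist (column_sums (sinkhorn_matrix a b K 1)) b
      in if \<Delta> = 0 then 1
         else 1 + 1 / (2 * ln (kernel_lambda K)) * ln (\<delta> * (1 - kernel_lambda K) / \<Delta>))"

definition k_tilde_potential ::
  "real ^ 'm \<Rightarrow> real ^ 'n \<Rightarrow> real ^ 'n ^ 'm \<Rightarrow> real \<Rightarrow> real \<Rightarrow> real" where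
  "k_tilde_potential a b C \<epsilon> \<delta> =
     (let lam = kernel_lambda (gibbs_kernel \<epsilon> C);
          b_min = Min (range (\<lambda>j. b $ j))
      in 1 - 4 * inverse b_min / (\<delta> * (1 - lam) + 2 - sqrt (\<delta>\<^sup>2 * (1 - lam)\<^sup>2 + 4))
             * ln (exp (- entry_max_norm C / \<epsilon>) * Min (range (\<lambda>(i, j). min (a $ i) (b $ j)))))"

definition k_tilde :: "real ^ 'm \<Rightarrow> real ^ 'n \<Rightarrow> real ^ 'n ^ 'm \<Rightarrow> real \<Rightarrow> real \<Rightarrow> real" where
  "k_tilde a b C \<epsilon> \<delta> = min (k_tilde_contraction a b (gibbs_kernel \<epsilon> C) \<delta>) (k_tilde_potential a b C \<epsilon> \<delta>)"

end

theory Submission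
  imports Defs
begin

text \<open>
  A coupling of finitely supported measures is a matrix with the prescribed marginals. If
  \<open>Q = diag(u) K diag(v)\<close> is such a matrix, the entropic objective is a constant plus \<open>\<epsilon>\<close> times the
  relative entropy with respect to \<open>Q\<close>, so \<open>Q\<close> is the unique optimum.

  Let \<open>c\<^sub>k\<close> be the column sums of the \<open>k\<close>-th iterate. By Birkhoff's theorem a full Sinkhorn step
  contracts Hilbert's metric by \<open>\<lambda>\<^sup>2\<close>. This bounds the distances of both scalings to the optimal ones
  by \<open>d\<^sub>H(c\<^sub>k, b) / (1 - \<lambda>)\<close>, and hence the entrywise error by \<open>e\<^sup>\<delta> - 1\<close> as soon as
  \<open>d\<^sub>H(c\<^sub>k, b) \<le> \<delta> (1 - \<lambda>)\<close>. Geometric decay of \<open>d\<^sub>H(c\<^sub>k, b)\<close> gives the first term of the minimum.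

  For the second term, let \<open>D\<close> be the relative entropy of \<open>Q\<close> with respect to the current state and
  \<open>E\<close> its marginal error in \<open>L\<^sup>1\<close>. Every half step lowers \<open>D\<close> by at least \<open>E\<^sup>2 / 2\<close> (Pinsker), does not
  increase \<open>E\<close>, and \<open>D \<le> (ln \<eta>(K) / 2) E\<close>. Hence \<open>E \<le> g\<close> after \<open>ln \<eta>(K) / g\<close> further full steps, and
  \<open>ln \<eta>(K) \<le> 4 \<parallel>C\<parallel> / \<epsilon>\<close>. Counting both half steps pays for the signs of the entries of \<open>C\<close>, which
  need not be nonnegative.
\<close>

section \<open>Relative entropy of finite distributions\<close>

definition kl :: "('a::finite \<Rightarrow> real) \<Rightarrow> ('a \<Rightarrow> real) \<Rightarrow> real" where
  "kl p q = (\<Sum>i\<in>UNIV. p i * ln (p i / q i))"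

lemma diff_le_mult_ln_divide:
  fixes p q :: real
  assumes "p \<ge> 0" "q > 0"
  shows "p - q \<le> p * ln (p / q)"
    and "p * ln (p / q) = p - q \<Longrightarrow> p = q"
proof -
  have *: "p - q \<le> p * ln (p / q) \<and> (p * ln (p / q) = p - q \<longrightarrow> p = q)"
  proof (cases "p = 0")
    case True
    then show ?thesis using assms by simp
  next
    case False
    then have p: "p > 0" using assms by simp
    have e: "p * ln (p / q) = - (p * ln (q / p))"
      using p assms by (simp add: ln_div algebra_simps)
    have "p * ln (q / p) \<le> p * (q / p - 1)"
      using ln_le_minus_one[of "q / p"] p assms by (intro mult_left_mono) auto
    moreover have "p * (q / p - 1) = q - p" using p by (simp add: field_simps)
    moreover have "p = q" if "p * ln (p / q) = p - q"
    proof -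
      have "p * ln (q / p) = p * (q / p - 1)"
        using that e \<open>p * (q / p - 1) = q - p\<close> by linarith
      then have "ln (q / p) = q / p - 1" using p by simp
      then have "q / p = 1" using ln_eq_minus_one[of "q / p"] p assms by simp
      then show ?thesis using p by simp
    qed
    ultimately show ?thesis using e by auto
  qed
  show "p - q \<le> p * ln (p / q)" "p * ln (p / q) = p - q \<Longrightarrow> p = q"
    using * by auto
qed

lemma kl_nonneg:
  assumes "\<And>i. p i \<ge> 0" "\<And>i. q i > 0" "sum p UNIV = sum q UNIV"
  shows "kl p q \<ge> 0"
proof -
  have "(\<Sum>i\<in>UNIV. p i - q i) \<le> kl p q"
    unfolding kl_def by (intro sum_mono diff_le_mult_ln_divide(1) assms)
  then show ?thesis using assms(3) by (simp add: sum_subtractf)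
qed

lemma kl_le_0_imp_eq:
  assumes "\<And>i. p i \<ge> 0" "\<And>i. q i > 0" "sum p UNIV = sum q UNIV" "kl p q \<le> 0"
  shows "p = q"
proof
  fix i
  have "(\<Sum>i\<in>UNIV. p i * ln (p i / q i) - (p i - q i)) \<le> 0"
    using assms(3,4) by (simp add: sum_subtractf kl_def)
  moreover have nn: "p i * ln (p i / q i) - (p i - q i) \<ge> 0" for i
    using diff_le_mult_ln_divide(1)[of "p i" "q i"] assms by simp
  ultimately have "(\<Sum>i\<in>UNIV. p i * ln (p i / q i) - (p i - q i)) = 0"
    by (intro antisym sum_nonneg) auto
  then have "p i * ln (p i / q i) - (p i - q i) = 0"
    using nn by (subst (asm) sum_nonneg_eq_0_iff) auto
  then show "p i = q i"
    using diff_le_mult_ln_divide(2)[of "p i" "q i"] assms by simp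
qed

section \<open>Pinsker's inequality\<close>

lemma ln_two_sided_bound:
  fixes t :: real
  assumes "t > 0"
  shows "t \<ge> 1 \<Longrightarrow> 2 * (t - 1) \<le> (t + 1) * ln t"
    and "t \<le> 1 \<Longrightarrow> (t + 1) * ln t \<le> 2 * (t - 1)"
proof -
  \<comment> \<open>The function \<open>f\<close> vanishes at 1 and is nondecreasing, because its
    derivative \<open>ln x + 1 / x - 1\<close> is nonnegative.\<close>
  define f where "f = (\<lambda>t::real. (t + 1) * ln t - 2 * (t - 1))"
  have d: "(f has_real_derivative ln x + 1 / x - 1) (at x)" if "x > 0" for x
    unfolding f_def using that by (auto intro!: derivative_eq_intros simp: field_simps)
  have nn: "ln x + 1 / x - 1 \<ge> 0" if "x > 0" for x :: real
    using ln_le_minus_one[of "1 / x"] that by (simp add: ln_div)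
  have mono: "f x \<le> f y" if "0 < x" "x \<le> y" for x y
    using that by (intro DERIV_nonneg_imp_nondecreasing[of x y f]) (auto intro!: exI d nn)
  have "f 1 = 0" by (simp add: f_def)
  then show "t \<ge> 1 \<Longrightarrow> 2 * (t - 1) \<le> (t + 1) * ln t"
    and "t \<le> 1 \<Longrightarrow> (t + 1) * ln t \<le> 2 * (t - 1)"
    using mono[of 1 t] mono[of t 1] assms by (auto simp: f_def)
qed

text \<open>The difference \<open>h\<close> of the two sides vanishes at 1, and by
  \<open>ln_two_sided_bound\<close> its derivative \<open>h'\<close> has the sign of
  \<open>t - 1\<close>. So \<open>h\<close> is minimal at 1.\<close>

lemma pinsker_pointwise:
  fixes t :: real
  assumes "t > 0"
  shows "3 * (t - 1)\<^sup>2 \<le> (4 + 2 * t) * (t * ln t - t + 1)"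
proof -
  define h where "h = (\<lambda>t::real. (4 + 2 * t) * (t * ln t - t + 1) - 3 * (t - 1)\<^sup>2)"
  define h' where "h' = (\<lambda>t::real. 4 * ((t + 1) * ln t - 2 * (t - 1)))"
  have d: "(h has_real_derivative h' x) (at x)" if "x > 0" for x
    unfolding h_def h'_def using that
    by (auto intro!: derivative_eq_intros simp: field_simps power2_eq_square)
  have "h 1 = 0" by (simp add: h_def)
  have "h 1 \<le> h t"
  proof (cases "t \<ge> 1")
    case True
    show ?thesis
    proof (rule DERIV_nonneg_imp_nondecreasing[OF True])
      fix x :: real assume "1 \<le> x" "x \<le> t"
      then show "\<exists>y. DERIV h x :> y \<and> 0 \<le> y"
        using d[of x] ln_two_sided_bound(1)[of x] by (auto simp: h'_def)
    qed
  next
    case False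
    show ?thesis
    proof (rule DERIV_nonpos_imp_nonincreasing[of t 1 h])
      show "t \<le> 1" using False by simp
      fix x :: real assume "t \<le> x" "x \<le> 1"
      then show "\<exists>y. DERIV h x :> y \<and> y \<le> 0"
        using d[of x] ln_two_sided_bound(2)[of x] assms by (auto simp: h'_def)
    qed
  qed
  then show ?thesis using \<open>h 1 = 0\<close> by (simp add: h_def)
qed

text \<open>Homogenised at \<open>t = p i / q i\<close>, the pointwise bound reads
  \<open>(p i - q i)\<^sup>2 \<le> w i * z i\<close>. Cauchy-Schwarz finishes, as the weights
  \<open>w\<close> sum to 2 and the terms \<open>z\<close> to \<open>kl p q\<close>.\<close>

lemma pinsker:
  assumes p: "\<And>i. p i > 0" and q: "\<And>i. q i > 0"
    and sp: "sum p UNIV = 1" and sq: "sum q UNIV = 1"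
  shows "(\<Sum>i\<in>UNIV. \<bar>p i - q i\<bar>)\<^sup>2 / 2 \<le> kl p q"
proof -
  define w where "w i = (4 * q i + 2 * p i) / 3" for i
  define z where "z i = p i * ln (p i / q i) - p i + q i" for i
  have z: "z i \<ge> 0" for i
    using diff_le_mult_ln_divide(1)[of "p i" "q i"] p[of i] q[of i] by (simp add: z_def)
  have w: "w i \<ge> 0" for i using p[of i] q[of i] by (simp add: w_def)
  have pt: "\<bar>p i - q i\<bar> \<le> sqrt (w i) * sqrt (z i)" for i
  proof -
    define t where "t = p i / q i"
    have t: "t > 0" and pe: "p i = q i * t" using p[of i] q[of i] by (auto simp: t_def)
    have "(p i - q i)\<^sup>2 = (q i)\<^sup>2 * (t - 1)\<^sup>2"
      unfolding pe by (simp add: power2_eq_square algebra_simps)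
    also have "\<dots> \<le> (q i)\<^sup>2 * ((4 + 2 * t) / 3 * (t * ln t - t + 1))"
      using pinsker_pointwise[OF t] by (intro mult_left_mono) auto
    also have "\<dots> = w i * z i"
      unfolding w_def z_def pe using q[of i] by (simp add: power2_eq_square field_simps)
    finally have "sqrt ((p i - q i)\<^sup>2) \<le> sqrt (w i * z i)" by (rule real_sqrt_le_mono)
    then show ?thesis by (simp add: real_sqrt_mult)
  qed
  have "(\<Sum>i\<in>UNIV. \<bar>p i - q i\<bar>)\<^sup>2 \<le> (\<Sum>i\<in>UNIV. sqrt (w i) * sqrt (z i))\<^sup>2"
    by (intro power_mono sum_mono pt sum_nonneg) auto
  also have "\<dots> \<le> (\<Sum>i\<in>UNIV. (sqrt (w i))\<^sup>2) * (\<Sum>i\<in>UNIV. (sqrt (z i))\<^sup>2)"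
    by (rule Cauchy_Schwarz_ineq_sum)
  also have "\<dots> = (\<Sum>i\<in>UNIV. w i) * (\<Sum>i\<in>UNIV. z i)"
    using w z by simp
  also have "(\<Sum>i\<in>UNIV. w i) = 2"
    unfolding w_def using sp sq
    by (simp add: sum_divide_distrib[symmetric] sum.distrib sum_distrib_left[symmetric])
  also have "(\<Sum>i\<in>UNIV. z i) = kl p q"
    unfolding z_def kl_def using sp sq by (simp add: sum.distrib sum_subtractf)
  finally show ?thesis by simp
qed

section \<open>Pairings with the difference of two distributions of equal mass\<close>

lemma sum_abs_diff_eq:
  fixes p q :: "'a::finite \<Rightarrow> real"
  assumes "sum p UNIV = sum q UNIV"
  shows "(\<Sum>i\<in>UNIV. \<bar>p i - q i\<bar>) = 2 * (\<Sum>i | p i > q i. p i - q i)"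
proof -
  have "(\<Sum>i\<in>UNIV. \<bar>p i - q i\<bar>) = (\<Sum>i\<in>UNIV. 2 * (if p i > q i then p i - q i else 0) - (p i - q i))"
    by (intro sum.cong) auto
  also have "\<dots> = 2 * (\<Sum>i\<in>UNIV. if p i > q i then p i - q i else 0)"
    using assms by (simp add: sum_subtractf sum_distrib_left)
  also have "(\<Sum>i\<in>UNIV. if p i > q i then p i - q i else 0) = (\<Sum>i | p i > q i. p i - q i)"
    by (subst sum.If_cases) auto
  finally show ?thesis .
qed

text \<open>Equal masses allow \<open>f\<close> to be shifted by its minimum. The shifted function
  lies between 0 and \<open>L\<close>, so only indices with \<open>p i > q i\<close> contribute
  positively, and their surplus is half of the sum on the right.\<close>

lemma sum_diff_mult_le_oscillation:
  fixes p q f :: "'a::finite \<Rightarrow> real"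
  assumes eq: "sum p UNIV = sum q UNIV" and osc: "\<And>i j. f i - f j \<le> L"
  shows "(\<Sum>i\<in>UNIV. (p i - q i) * f i) \<le> L / 2 * (\<Sum>i\<in>UNIV. \<bar>p i - q i\<bar>)"
proof -
  define m where "m = Min (range f)"
  have "m \<in> range f" unfolding m_def by (rule Min_in) auto
  then obtain l where l: "m = f l" by auto
  have fm: "f i \<ge> m" for i by (simp add: m_def)
  have "(\<Sum>i\<in>UNIV. (p i - q i) * f i) = (\<Sum>i\<in>UNIV. (p i - q i) * (f i - m)) + m * (\<Sum>i\<in>UNIV. p i - q i)"
    by (simp add: sum.distrib[symmetric] sum_distrib_left algebra_simps)
  also have "\<dots> = (\<Sum>i\<in>UNIV. (p i - q i) * (f i - m))"
    using eq by (simp add: sum_subtractf)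
  also have "\<dots> \<le> (\<Sum>i\<in>UNIV. if p i > q i then (p i - q i) * L else 0)"
  proof (rule sum_mono)
    fix i
    show "(p i - q i) * (f i - m) \<le> (if p i > q i then (p i - q i) * L else 0)"
      using osc[of i l] fm[of i] l
      by (auto intro: mult_left_mono mult_nonpos_nonneg)
  qed
  also have "\<dots> = (\<Sum>i | p i > q i. (p i - q i) * L)"
    by (subst sum.If_cases) auto
  also have "\<dots> = L * (\<Sum>i | p i > q i. p i - q i)"
    by (simp add: sum_distrib_left mult.commute)
  also have "\<dots> = L / 2 * (\<Sum>i\<in>UNIV. \<bar>p i - q i\<bar>)"
    using sum_abs_diff_eq[OF eq] by simp
  finally show ?thesis .
qed

text \<open>A surplus or deficit at one index is compensated at the others, so it counts at least
  twice in the sum.\<close>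

lemma abs_diff_le_half_sum_abs_diff:
  fixes p q :: "'a::finite \<Rightarrow> real"
  assumes eq: "sum p UNIV = sum q UNIV"
  shows "\<bar>p i - q i\<bar> \<le> (\<Sum>i\<in>UNIV. \<bar>p i - q i\<bar>) / 2"
proof -
  have "(\<Sum>j\<in>UNIV. (p j - q j)) = 0" using eq by (simp add: sum_subtractf)
  then have "p i - q i = - (\<Sum>j\<in>UNIV - {i}. p j - q j)"
    by (simp add: sum.remove[of _ i])
  then have "\<bar>p i - q i\<bar> \<le> (\<Sum>j\<in>UNIV - {i}. \<bar>p j - q j\<bar>)"
    using sum_abs[of "\<lambda>j. p j - q j" "UNIV - {i}"] by simp
  also have "\<dots> = (\<Sum>j\<in>UNIV. \<bar>p j - q j\<bar>) - \<bar>p i - q i\<bar>"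
    by (simp add: sum.remove[of _ i])
  finally show ?thesis by simp
qed

text \<open>
  The function \<open>\<lambda>d. if d \<le> 1 then d else 2 - 1 / d\<close> is concave with derivative
  \<open>min 1 (1 / d\<^sup>2)\<close>, so that every step \<open>d \<mapsto> d'\<close> below lowers it by at least \<open>\<kappa>\<close>.
\<close>

definition gap_potential :: "real \<Rightarrow> real" where
  "gap_potential d = (if d \<le> 1 then d else 2 - 1 / d)"

lemma gap_potential_step:
  assumes "d' \<ge> 0" "d' \<le> d - \<kappa>" "d' \<le> d - \<kappa> * d\<^sup>2" "\<kappa> > 0"
  shows "gap_potential d' \<le> gap_potential d - \<kappa>"
proof -
  consider "d \<le> 1" | "d > 1" "d' \<le> 1" | "d' > 1" using assms by linarith
  then show ?thesis
  proof cases
    case 1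
    then have "d' \<le> 1" using assms by linarith
    then show ?thesis using 1 assms by (simp add: gap_potential_def)
  next
    \<comment> \<open>This case and the next use the quadratic decrease; here the claim is
      multiplied by \<open>d\<^sup>2\<close> to clear the denominator.\<close>
    case 2
    have "d\<^sup>2 * (\<kappa> - (2 - 1 / d - d')) = \<kappa> * d\<^sup>2 - 2 * d\<^sup>2 + d + d\<^sup>2 * d'"
      using 2 by (simp add: power2_eq_square field_simps)
    also have "\<dots> \<le> d - d' - 2 * d\<^sup>2 + d + d\<^sup>2 * d'" using assms by simp
    also have "\<dots> = (d\<^sup>2 - 1) * (d' - 1) - (d - 1)\<^sup>2"
      by (simp add: power2_eq_square algebra_simps)
    also have "\<dots> \<le> 0"
    proof -
      have "(d\<^sup>2 - 1) * (d' - 1) \<le> 0"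
        using 2 by (intro mult_nonneg_nonpos) auto
      then show ?thesis using zero_le_power2[of "d - 1"] by linarith
    qed
    finally have "\<kappa> - (2 - 1 / d - d') \<le> 0"
      using 2 by (simp add: mult_le_0_iff)
    then show ?thesis using 2 by (simp add: gap_potential_def)
  next
    case 3
    then have "d \<ge> d'" "d > 1" using assms by auto
    have "\<kappa> * (d * d') \<le> \<kappa> * d\<^sup>2"
      using \<open>d \<ge> d'\<close> 3 assms(4) by (intro mult_left_mono) (auto simp: power2_eq_square)
    also have "\<dots> \<le> d - d'" using assms by simp
    finally have "\<kappa> \<le> (d - d') / (d * d')" using 3 \<open>d > 1\<close> by (simp add: pos_le_divide_eq)
    also have "\<dots> = 1 / d' - 1 / d" using 3 \<open>d > 1\<close> by (simp add: field_simps)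
    finally show ?thesis using 3 \<open>d > 1\<close> by (simp add: gap_potential_def)
  qed
qed

text \<open>If \<open>E n > g\<close>, monotonicity gives \<open>E k > g\<close> for all
  \<open>k \<le> n\<close>. Then each half step lowers the gap potential of
  \<open>D / (B * g)\<close> by at least \<open>\<kappa> = g / (2 * B)\<close>. The potential stays
  in \<open>[0, 2)\<close>, so \<open>n\<close> full steps force
  \<open>2 * \<kappa> * n < 2\<close>, contradicting the choice of \<open>n\<close>.\<close>

lemma alternating_decrease_bound:
  fixes D D' E E' :: "nat \<Rightarrow> real"
  assumes D: "\<And>k. D k \<ge> 0" "\<And>k. D' k \<ge> 0" "\<And>k. E k \<ge> 0"
    and bound: "\<And>k. D k \<le> B * E k" "\<And>k. D' k \<le> B * E' k"
    and dec: "\<And>k. D' k \<le> D k - (E k)\<^sup>2 / 2" "\<And>k. D (Suc k) \<le> D' k - (E' k)\<^sup>2 / 2"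
    and E: "\<And>k. E' k \<le> E k" "\<And>k. E (Suc k) \<le> E' k"
    and B: "B \<ge> 0" and g: "g > 0" and n: "2 * B / g \<le> real n"
  shows "E n \<le> g"
proof (rule ccontr)
  assume "\<not> E n \<le> g"
  then have En: "E n > g" by simp
  have anti: "E (Suc k) \<le> E k" for k using E order_trans by blast
  have Ek: "E k > g" if "k \<le> n" for k
    using lift_Suc_antimono_le[of E, OF anti that] En by linarith
  show False
  proof (cases "B = 0")
    \<comment> \<open>Here \<open>D n \<le> 0\<close>, so one more decrease would make
      \<open>D' n\<close> negative. The rescaling in the other case divides by
      \<open>B\<close>.\<close>
    case True
    have "(E n)\<^sup>2 > 0" using En g by simp
    moreover have "D n \<le> 0" using bound(1)[of n] True by simp
    ultimately show ?thesis using dec(1)[of n] D(2)[of n] by linarith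
  next
    case False
    then have B: "B > 0" using B by simp
    define \<kappa> where "\<kappa> = g / (2 * B)"
    define \<phi> where "\<phi> d = gap_potential (d / (B * g))" for d
    have \<kappa>: "\<kappa> > 0" using g B by (simp add: \<kappa>_def)
    \<comment> \<open>The bound \<open>e \<ge> g\<close> yields the constant decrease, and
      \<open>e \<ge> d / B\<close> the quadratic one.\<close>
    have step: "\<phi> d' \<le> \<phi> d - \<kappa>"
      if "d' \<ge> 0" "d' \<le> d - e\<^sup>2 / 2" "d \<le> B * e" "e \<ge> g" for d d' e
      unfolding \<phi>_def
    proof (rule gap_potential_step)
      show "0 \<le> d' / (B * g)" using that g B by simp
      have "g\<^sup>2 \<le> e\<^sup>2" using that g by (intro power_mono) auto
      then have "d' \<le> d - g\<^sup>2 / 2" using that by simp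
      then have "d' / (B * g) \<le> (d - g\<^sup>2 / 2) / (B * g)" using g B by (intro divide_right_mono) auto
      also have "\<dots> = d / (B * g) - \<kappa>" using g B by (simp add: \<kappa>_def field_simps power2_eq_square)
      finally show "d' / (B * g) \<le> d / (B * g) - \<kappa>" .
      have "d \<ge> 0" using that zero_le_power2[of e] by linarith
      then have "d\<^sup>2 \<le> (B * e)\<^sup>2" using that by (intro power_mono) auto
      then have "d\<^sup>2 / B\<^sup>2 \<le> e\<^sup>2" using B by (simp add: power_mult_distrib field_simps)
      then have "d' \<le> d - d\<^sup>2 / B\<^sup>2 / 2" using that by simp
      then have "d' / (B * g) \<le> (d - d\<^sup>2 / B\<^sup>2 / 2) / (B * g)" using g B by (intro divide_right_mono) auto
      also have "\<dots> = d / (B * g) - \<kappa> * (d / (B * g))\<^sup>2"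
        using g B by (simp add: \<kappa>_def field_simps power2_eq_square)
      finally show "d' / (B * g) \<le> d / (B * g) - \<kappa> * (d / (B * g))\<^sup>2" .
    qed (rule \<kappa>)
    have full: "\<phi> (D (Suc k)) \<le> \<phi> (D k) - 2 * \<kappa>" if "Suc k \<le> n" for k
    proof -
      have "\<phi> (D' k) \<le> \<phi> (D k) - \<kappa>"
        using that Ek[of k] by (intro step[OF D(2) dec(1) bound(1)]) auto
      \<comment> \<open>The bound \<open>E' k \<ge> g\<close> is inferred from
        \<open>E (Suc k) > g\<close>, hence the restriction to \<open>Suc k \<le> n\<close>.\<close>
      moreover have "\<phi> (D (Suc k)) \<le> \<phi> (D' k) - \<kappa>"
        using that Ek[of "Suc k"] E(2)[of k] by (intro step[OF D(1) dec(2) bound(2)]) auto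
      ultimately show ?thesis by simp
    qed
    have "\<phi> (D k) \<le> \<phi> (D 0) - 2 * \<kappa> * real k" if "k \<le> n" for k
      using that
    proof (induction k)
      case (Suc k)
      then show ?case using full[of k] by (simp add: algebra_simps)
    qed simp
    then have "2 * \<kappa> * real n \<le> \<phi> (D 0) - \<phi> (D n)" by (simp add: algebra_simps)
    also have "\<dots> < 2"
    proof -
      have "\<phi> d \<ge> 0" if "d \<ge> 0" for d
      proof -
        have "gap_potential r \<ge> 0" if "r \<ge> 0" for r
          using that le_divide_eq_1[of 1 r] by (auto simp: gap_potential_def divide_simps)
        then show ?thesis using that g B unfolding \<phi>_def by simp
      qed
      moreover have "\<phi> d < 2" for d
      proof -
        have "gap_potential r < 2" for r by (auto simp: gap_potential_def)
        then show ?thesis unfolding \<phi>_def .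
      qed
      ultimately have "\<phi> (D n) \<ge> 0" "\<phi> (D 0) < 2" using D(1) by auto
      then show ?thesis by simp
    qed
    also have "2 = 2 * \<kappa> * (2 * B / g)" using g B by (simp add: \<kappa>_def)
    finally have "real n < 2 * B / g" using \<kappa> mult_less_cancel_left_pos[of "2 * \<kappa>" "real n" "2 * B / g"] by simp
    then show ?thesis using n by simp
  qed
qed

section \<open>Hilbert's metric and Birkhoff's contraction theorem\<close>

text \<open>In additive form the metric is the oscillation of the logarithmic ratios; symmetry and
  the triangle inequality are read off from this.\<close>

lemma hilbert_dist_le_iff:
  assumes "\<And>i. p $ i > 0" "\<And>i. q $ i > 0"
  shows "hilbert_dist p q \<le> d \<longleftrightarrow> (\<forall>i j. ln (p $ i / q $ i) - ln (p $ j / q $ j) \<le> d)"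
proof -
  define R where "R = range (\<lambda>(i, j). (p $ i * q $ j) / (q $ i * p $ j))"
  have fin: "finite R" "R \<noteq> {}" by (auto simp: R_def)
  have pos: "r > 0" if "r \<in> R" for r using that assms by (auto simp: R_def)
  have "hilbert_dist p q \<le> d \<longleftrightarrow> ln (Max R) \<le> ln (exp d)"
    by (simp add: hilbert_dist_def R_def)
  also have "\<dots> \<longleftrightarrow> Max R \<le> exp d"
    using pos[OF Max_in[OF fin]] by (subst ln_le_cancel_iff) auto
  also have "\<dots> \<longleftrightarrow> (\<forall>r\<in>R. r \<le> exp d)" by (rule Max_le_iff[OF fin])
  also have "\<dots> \<longleftrightarrow> (\<forall>r\<in>R. ln r \<le> d)"
    using pos by (metis exp_le_cancel_iff exp_ln)
  also have "\<dots> \<longleftrightarrow> (\<forall>i j. ln (p $ i / q $ i) - ln (p $ j / q $ j) \<le> d)"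
    using assms by (auto simp: R_def ln_divide_pos ln_mult_pos algebra_simps)
  finally show ?thesis .
qed

lemma ln_ratio_diff_le_hilbert_dist:
  assumes "\<And>i. p $ i > 0" "\<And>i. q $ i > 0"
  shows "ln (p $ i / q $ i) - ln (p $ j / q $ j) \<le> hilbert_dist p q"
  using hilbert_dist_le_iff[OF assms, of "hilbert_dist p q"] by blast

lemma hilbert_dist_nonneg:
  assumes "\<And>i. p $ i > 0" "\<And>i. q $ i > 0"
  shows "hilbert_dist p q \<ge> 0"
  using ln_ratio_diff_le_hilbert_dist[OF assms, of undefined undefined] by simp

lemma hilbert_dist_self: "(\<And>i. p $ i > 0) \<Longrightarrow> hilbert_dist p p = 0"
  by (intro antisym hilbert_dist_nonneg) (auto simp: hilbert_dist_le_iff)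

lemma hilbert_dist_commute:
  assumes "\<And>i. p $ i > 0" "\<And>i. q $ i > 0"
  shows "hilbert_dist p q = hilbert_dist q p"
proof -
  have *: "hilbert_dist p q \<le> hilbert_dist q p" if pq: "\<And>i. p $ i > 0" "\<And>i. q $ i > 0" for p q :: "real ^ 'a"
    unfolding hilbert_dist_le_iff[OF pq]
  proof (intro allI)
    fix i j
    have "ln (q $ j / p $ j) - ln (q $ i / p $ i) \<le> hilbert_dist q p"
      by (rule ln_ratio_diff_le_hilbert_dist[OF pq(2,1)])
    then show "ln (p $ i / q $ i) - ln (p $ j / q $ j) \<le> hilbert_dist q p"
      using pq by (simp add: ln_divide_pos)
  qed
  show ?thesis using *[OF assms] *[OF assms(2,1)] by (rule antisym)
qed

lemma hilbert_dist_triangle: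
  assumes "\<And>i. p $ i > 0" "\<And>i. q $ i > 0" "\<And>i. r $ i > 0"
  shows "hilbert_dist p r \<le> hilbert_dist p q + hilbert_dist q r"
  unfolding hilbert_dist_le_iff[OF assms(1,3)]
proof (intro allI)
  fix i j
  show "ln (p $ i / r $ i) - ln (p $ j / r $ j) \<le> hilbert_dist p q + hilbert_dist q r"
    using ln_ratio_diff_le_hilbert_dist[OF assms(1,2), of i j] 
      ln_ratio_diff_le_hilbert_dist[OF assms(2,3), of i j] assms by (simp add: ln_divide_pos)
qed

text \<open>Division inverts every ratio and cancels \<open>c\<close>, so a Sinkhorn update
  contracts the metric exactly as its kernel does.\<close>

lemma hilbert_dist_vec_divide:
  assumes "\<And>i. c $ i > 0" "\<And>i. p $ i > 0" "\<And>i. q $ i > 0"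
  shows "hilbert_dist (c \<oslash> p) (c \<oslash> q) = hilbert_dist p q"
proof -
  have "(c \<oslash> p) $ i * (c \<oslash> q) $ j / ((c \<oslash> q) $ i * (c \<oslash> p) $ j) = q $ i * p $ j / (p $ i * q $ j)" for i j
    using assms[of i] assms[of j] by (simp add: vec_divide_def field_simps)
  then have "hilbert_dist (c \<oslash> p) (c \<oslash> q) = hilbert_dist q p"
    unfolding hilbert_dist_def by simp
  then show ?thesis using hilbert_dist_commute assms by metis
qed

lemma hilbert_dist_ratio_cong:
  assumes "\<And>i. p $ i / q $ i = p' $ i / q' $ i"
  shows "hilbert_dist p q = hilbert_dist p' q'"
proof -
  have "(p $ i * q $ j) / (q $ i * p $ j) = (p' $ i * q' $ j) / (q' $ i * p' $ j)" for i j
    using assms by (metis divide_divide_eq_left divide_divide_eq_right times_divide_eq_left mult.commute)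
  then show ?thesis by (simp add: hilbert_dist_def)
qed

section \<open>Cross ratios of a positive kernel\<close>

lemma kernel_eta_ge:
  "(K $ i $ k * K $ j $ l) / (K $ j $ k * K $ i $ l) \<le> kernel_eta K"
  unfolding kernel_eta_def by (rule Max_ge) (auto intro: range_eqI[of _ _ "(i, j, k, l)"])

lemma kernel_eta_ge_1:
  assumes "\<And>i j. K $ i $ j > 0"
  shows "kernel_eta K \<ge> 1"
  using kernel_eta_ge[of K undefined undefined undefined undefined] assms[of undefined undefined] by simp

lemma kernel_eta_le_iff:
  "kernel_eta K \<le> r \<longleftrightarrow> (\<forall>i j k l. (K $ i $ k * K $ j $ l) / (K $ j $ k * K $ i $ l) \<le> r)"
  unfolding kernel_eta_def by (subst Max_le_iff) auto

lemma kernel_eta_transpose_le: "kernel_eta (transpose K) \<le> kernel_eta K"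
  unfolding kernel_eta_le_iff
proof (intro allI)
  fix i j k l
  show "transpose K $ i $ k * transpose K $ j $ l / (transpose K $ j $ k * transpose K $ i $ l) \<le> kernel_eta K"
    using kernel_eta_ge[of K k i l j] by (simp add: transpose_def mult.commute)
qed

lemma kernel_eta_transpose: "kernel_eta (transpose K) = kernel_eta K"
  using kernel_eta_transpose_le[of K] kernel_eta_transpose_le[of "transpose K"]
  by (simp add: transpose_transpose)

lemma kernel_lambda_transpose: "kernel_lambda (transpose K) = kernel_lambda K"
  by (simp add: kernel_lambda_def kernel_eta_transpose)

lemma kernel_lambda_bounds:
  assumes "\<And>i j. K $ i $ j > 0"
  shows "0 \<le> kernel_lambda K" "kernel_lambda K < 1"
proof -
  have "sqrt (kernel_eta K) \<ge> 1" using kernel_eta_ge_1[OF assms] by simp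
  moreover from this have "sqrt (kernel_eta K) + 1 > 0" by linarith
  ultimately show "0 \<le> kernel_lambda K" "kernel_lambda K < 1"
    by (simp_all add: kernel_lambda_def pos_divide_less_eq)
qed

text \<open>The bound holds term by term after expanding both products. The index sets are free
  because the image diameter needs full sums, and Birkhoff's theorem a set and its
  complement.\<close>

lemma sum_mult_sum_le_kernel_eta:
  assumes K: "\<And>i j. K $ i $ j > 0" and x: "\<And>j. x j \<ge> 0" and y: "\<And>j. y j \<ge> 0"
  shows "(\<Sum>j\<in>S. K $ i $ j * x j) * (\<Sum>l\<in>T. K $ k $ l * y l)
    \<le> kernel_eta K * ((\<Sum>j\<in>S. K $ k $ j * x j) * (\<Sum>l\<in>T. K $ i $ l * y l))"
proof -
  have "(\<Sum>j\<in>S. K $ i $ j * x j) * (\<Sum>l\<in>T. K $ k $ l * y l)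
      = (\<Sum>j\<in>S. \<Sum>l\<in>T. (K $ i $ j * K $ k $ l) * (x j * y l))"
    by (simp add: sum_product algebra_simps)
  also have "\<dots> \<le> (\<Sum>j\<in>S. \<Sum>l\<in>T. (kernel_eta K * (K $ k $ j * K $ i $ l)) * (x j * y l))"
  proof (intro sum_mono mult_right_mono)
    fix j l
    show "K $ i $ j * K $ k $ l \<le> kernel_eta K * (K $ k $ j * K $ i $ l)"
      using kernel_eta_ge[of K i j k l] K by (simp add: pos_divide_le_eq)
    show "0 \<le> x j * y l" using x y by simp
  qed
  also have "\<dots> = kernel_eta K * ((\<Sum>j\<in>S. K $ k $ j * x j) * (\<Sum>l\<in>T. K $ i $ l * y l))"
    by (subst sum_product, unfold sum_distrib_left, intro sum.cong refl) (simp add: algebra_simps)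
  finally show ?thesis .
qed

lemma matrix_vector_mult_pos:
  fixes K :: "real ^ 'n ^ 'm"
  assumes "\<And>i j. K $ i $ j > 0" "\<And>j. x $ j > 0"
  shows "(K *v x) $ i > 0"
  unfolding matrix_vector_mult_def using assms by (auto intro!: sum_pos)

text \<open>This bounds the Hilbert diameter of the image of the positive cone, whatever the
  distance between \<open>x\<close> and \<open>y\<close>.\<close>

lemma hilbert_dist_matrix_vector_mult_le_ln_eta:
  assumes K: "\<And>i j. K $ i $ j > 0" and x: "\<And>j. x $ j > 0" and y: "\<And>j. y $ j > 0"
  shows "hilbert_dist (K *v x) (K *v y) \<le> ln (kernel_eta K)"
proof -
  note pos = matrix_vector_mult_pos[OF K x] matrix_vector_mult_pos[OF K y]
  show ?thesis
    unfolding hilbert_dist_le_iff[of "K *v x" "K *v y", OF pos]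
  proof (intro allI)
    fix i k
    have "(K *v x) $ i * (K *v y) $ k \<le> kernel_eta K * ((K *v x) $ k * (K *v y) $ i)"
      using sum_mult_sum_le_kernel_eta[OF K, where x = "\<lambda>j. x $ j" and y = "\<lambda>j. y $ j" and S = UNIV and T = UNIV and i = i and k = k] x y
      by (simp add: matrix_vector_mult_def less_imp_le)
    then have "ln ((K *v x) $ i * (K *v y) $ k) \<le> ln (kernel_eta K * ((K *v x) $ k * (K *v y) $ i))"
      using pos kernel_eta_ge_1[OF K] by (subst ln_le_cancel_iff) (auto intro!: mult_pos_pos)
    then show "ln ((K *v x) $ i / (K *v y) $ i) - ln ((K *v x) $ k / (K *v y) $ k) \<le> ln (kernel_eta K)"
      using pos[of i] pos[of k] kernel_eta_ge_1[OF K] by (simp add: ln_divide_pos ln_mult_pos)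
  qed
qed

text \<open>With \<open>\<alpha> = sqrt (P * (1 - Q))\<close> and
  \<open>\<beta> = sqrt (Q * (1 - P))\<close>, the difference is
  \<open>(\<alpha> - \<beta>) * (\<alpha> + \<beta>)\<close>. The odds bound becomes
  \<open>\<alpha> \<le> sqrt \<eta> * \<beta>\<close>, and the inequality of arithmetic and
  geometric means gives \<open>\<alpha> + \<beta> \<le> 1\<close>.\<close>

lemma odds_ratio_imp_diff_le:
  fixes P Q \<eta> :: real
  assumes P: "0 \<le> P" "P \<le> 1" and Q: "0 \<le> Q" "Q \<le> 1" and \<eta>: "\<eta> \<ge> 1"
    and odds: "P * (1 - Q) \<le> \<eta> * (Q * (1 - P))"
  shows "P - Q \<le> (sqrt \<eta> - 1) / (sqrt \<eta> + 1)"
proof -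
  define \<alpha> where "\<alpha> = sqrt (P * (1 - Q))"
  define \<beta> where "\<beta> = sqrt (Q * (1 - P))"
  have sq: "\<alpha>\<^sup>2 = P * (1 - Q)" "\<beta>\<^sup>2 = Q * (1 - P)" and nn: "\<alpha> \<ge> 0" "\<beta> \<ge> 0"
    using P Q by (auto simp: \<alpha>_def \<beta>_def)
  have h: "sqrt \<eta> \<ge> 1" using \<eta> by simp
  have le: "\<alpha> \<le> sqrt \<eta> * \<beta>"
    unfolding \<alpha>_def \<beta>_def using odds by (simp flip: real_sqrt_mult)
  have "\<alpha> \<le> (P + (1 - Q)) / 2" "\<beta> \<le> (Q + (1 - P)) / 2"
    unfolding \<alpha>_def \<beta>_def using P Q by (intro arith_geo_mean_sqrt; simp)+
  then have sum: "\<alpha> + \<beta> \<le> 1" by argo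
  have "P - Q = \<alpha>\<^sup>2 - \<beta>\<^sup>2" unfolding sq by (simp add: algebra_simps)
  also have "\<dots> = (\<alpha> - \<beta>) * (\<alpha> + \<beta>)" by (simp add: power2_eq_square algebra_simps)
  also have "\<dots> \<le> (sqrt \<eta> - 1) / (sqrt \<eta> + 1)"
  proof (cases "\<alpha> \<le> \<beta>")
    case True
    then have "(\<alpha> - \<beta>) * (\<alpha> + \<beta>) \<le> 0" using nn by (simp add: mult_nonpos_nonneg)
    then show ?thesis using h by (intro order_trans[OF \<open>_ \<le> 0\<close>] divide_nonneg_nonneg) auto
  next
    case False
    then have "(\<alpha> - \<beta>) * (\<alpha> + \<beta>) \<le> \<alpha> - \<beta>" using sum nn by (simp add: mult_left_le)
    also have "\<dots> \<le> (sqrt \<eta> - 1) / (sqrt \<eta> + 1)"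
    proof -
      have "(\<alpha> - \<beta>) * (sqrt \<eta> + 1) \<le> (sqrt \<eta> - 1) * (\<alpha> + \<beta>)"
        using le by (simp add: algebra_simps)
      also have "\<dots> \<le> sqrt \<eta> - 1" using h sum by (simp add: mult_left_le)
      finally have "(\<alpha> - \<beta>) * (sqrt \<eta> + 1) \<le> sqrt \<eta> - 1" .
      moreover have "sqrt \<eta> + 1 > 0" using h by linarith
      ultimately show ?thesis by (simp only: pos_le_divide_eq)
    qed
    finally show ?thesis .
  qed
  finally show ?thesis .
qed

text \<open>
  Along the geodesic \<open>\<tau> \<mapsto> y r\<^sup>\<tau>\<close> from \<open>y\<close> to \<open>x = y r\<close>, the derivative of
  \<open>ln (K x\<^sub>\<tau>)\<^sub>i - ln (K x\<^sub>\<tau>)\<^sub>k\<close> is the difference of the means of \<open>ln r\<close> under two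
  probability vectors whose odds ratios are at most \<open>\<eta>(K)\<close>, hence whose total variation
  distance is at most \<open>\<lambda>(K)\<close>.
\<close>

theorem birkhoff_contraction:
  fixes K :: "real ^ 'n ^ 'm"
  assumes K: "\<And>i j. K $ i $ j > 0" and x: "\<And>j. x $ j > 0" and y: "\<And>j. y $ j > 0"
  shows "hilbert_dist (K *v x) (K *v y) \<le> kernel_lambda K * hilbert_dist x y"
proof -
  define w where "w j = ln (x $ j / y $ j)" for j
  define z where "z \<tau> j = y $ j * exp (\<tau> * w j)" for \<tau> j
  define S where "S \<tau> i = (\<Sum>j\<in>UNIV. K $ i $ j * z \<tau> j)" for \<tau> i
  define S' where "S' \<tau> i = (\<Sum>j\<in>UNIV. K $ i $ j * z \<tau> j * w j)" for \<tau> i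
  have z: "z \<tau> j > 0" for \<tau> j using y by (simp add: z_def)
  have S: "S \<tau> i > 0" for \<tau> i unfolding S_def using K z by (auto intro!: sum_pos)
  have z0: "z 0 = ($) y" and z1: "z 1 = ($) x"
    using x y by (auto simp: z_def w_def exp_ln[OF divide_pos_pos] fun_eq_iff) 
      (metis less_irrefl)+
  have S01: "S 0 i = (K *v y) $ i" "S 1 i = (K *v x) $ i" for i
    by (simp_all add: S_def z0 z1 matrix_vector_mult_def)
  have dS: "((\<lambda>\<tau>. S \<tau> i) has_real_derivative S' \<tau> i) (at \<tau>)" for \<tau> i
    unfolding S_def S'_def z_def by (auto intro!: derivative_eq_intros sum.cong simp: algebra_simps)
  have d: "((\<lambda>\<tau>. ln (S \<tau> i) - ln (S \<tau> k)) has_real_derivative (S' \<tau> i / S \<tau> i - S' \<tau> k / S \<tau> k)) (at \<tau>)" for \<tau> i k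
    using S[of \<tau> i] S[of \<tau> k] by (auto intro!: derivative_eq_intros dS)
  have bound: "S' \<tau> i / S \<tau> i - S' \<tau> k / S \<tau> k \<le> kernel_lambda K * hilbert_dist x y" for \<tau> i k
  proof -
    define p where "p = (\<lambda>j. K $ i $ j * z \<tau> j / S \<tau> i)"
    define q where "q = (\<lambda>j. K $ k $ j * z \<tau> j / S \<tau> k)"
    \<comment> \<open>On \<open>J\<close> the difference of \<open>p\<close> and \<open>q\<close>
      attains their total variation distance, and the odds of \<open>J\<close> under
      \<open>p\<close> are at most \<open>kernel_eta K\<close> times those under
      \<open>q\<close>.\<close>
    define J where "J = {j. p j > q j}"
    have pos: "p j > 0" "q j > 0" for j using K z S by (auto simp: p_def q_def)
    have sums: "sum p UNIV = 1" "sum q UNIV = 1"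
      using S[of \<tau> i] S[of \<tau> k] by (auto simp: p_def q_def S_def simp flip: sum_divide_distrib)
    have compl: "sum p (- J) = 1 - sum p J" "sum q (- J) = 1 - sum q J"
      using sums by (simp_all add: Compl_eq_Diff_UNIV sum_diff)
    have "sum p J * sum q (- J) \<le> kernel_eta K * (sum q J * sum p (- J))"
    proof -
      have "sum p J * sum q (- J) = (\<Sum>j\<in>J. K $ i $ j * z \<tau> j) * (\<Sum>j\<in>-J. K $ k $ j * z \<tau> j) / (S \<tau> i * S \<tau> k)"
        by (simp add: p_def q_def flip: sum_divide_distrib)
      also have "\<dots> \<le> kernel_eta K * ((\<Sum>j\<in>J. K $ k $ j * z \<tau> j) * (\<Sum>j\<in>-J. K $ i $ j * z \<tau> j)) / (S \<tau> i * S \<tau> k)"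
        using S[of \<tau> i] S[of \<tau> k] z
        by (intro divide_right_mono sum_mult_sum_le_kernel_eta[OF K]) (auto intro: less_imp_le)
      also have "\<dots> = kernel_eta K * (sum q J * sum p (- J))"
        by (simp add: p_def q_def mult.commute flip: sum_divide_distrib)
      finally show ?thesis .
    qed
    moreover have "sum p J \<le> 1" "sum q J \<le> 1"
      using sums pos sum_mono2[of UNIV J p] sum_mono2[of UNIV J q] by (auto intro: less_imp_le)
    ultimately have "sum p J - sum q J \<le> kernel_lambda K"
      unfolding kernel_lambda_def using kernel_eta_ge_1[OF K] pos
      by (intro odds_ratio_imp_diff_le) (auto simp: compl less_imp_le intro: sum_nonneg)
    then have tv: "(\<Sum>j\<in>UNIV. \<bar>p j - q j\<bar>) / 2 \<le> kernel_lambda K"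
      using sum_abs_diff_eq[of p q] sums by (simp add: J_def sum_subtractf)
    have "S' \<tau> i / S \<tau> i - S' \<tau> k / S \<tau> k = (\<Sum>j\<in>UNIV. (p j - q j) * w j)"
      by (simp add: S'_def p_def q_def left_diff_distrib sum_subtractf sum_divide_distrib)
    also have "\<dots> \<le> hilbert_dist x y / 2 * (\<Sum>j\<in>UNIV. \<bar>p j - q j\<bar>)"
      using sums ln_ratio_diff_le_hilbert_dist[of x y, OF x y]
      by (intro sum_diff_mult_le_oscillation) (auto simp: w_def)
    also have "\<dots> = hilbert_dist x y * ((\<Sum>j\<in>UNIV. \<bar>p j - q j\<bar>) / 2)" by simp
    also have "\<dots> \<le> hilbert_dist x y * kernel_lambda K"
      by (intro mult_left_mono tv hilbert_dist_nonneg x y)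
    finally show ?thesis by (simp add: mult.commute)
  qed
  note pos = matrix_vector_mult_pos[OF K x] matrix_vector_mult_pos[OF K y]
  show ?thesis
    unfolding hilbert_dist_le_iff[of "K *v x" "K *v y", OF pos]
  proof (intro allI)
    fix i k
    obtain \<tau> where "(ln (S 1 i) - ln (S 1 k)) - (ln (S 0 i) - ln (S 0 k))
        = (1 - 0) * (S' \<tau> i / S \<tau> i - S' \<tau> k / S \<tau> k)"
      using MVT2[of 0 1 "\<lambda>\<tau>. ln (S \<tau> i) - ln (S \<tau> k)" "\<lambda>\<tau>. S' \<tau> i / S \<tau> i - S' \<tau> k / S \<tau> k"] d
      by auto
    then show "ln ((K *v x) $ i / (K *v y) $ i) - ln ((K *v x) $ k / (K *v y) $ k) \<le> kernel_lambda K * hilbert_dist x y"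
      using bound[of \<tau> i k] pos[of i] pos[of k] by (simp add: S01 ln_divide_pos)
  qed
qed

section \<open>Relative entropy under rescaling\<close>

text \<open>The simplifier would otherwise turn \<open>transpose K *v x\<close> into
  \<open>x v* K\<close>, away from the form in which the algorithm is written.\<close>

declare transpose_matrix_vector [simp del]

lemma kl_pair_eq:
  "kl (\<lambda>(i, j). Q i j) (\<lambda>(i, j). P i j) = (\<Sum>i\<in>UNIV. \<Sum>j\<in>UNIV. Q i j * ln (Q i j / P i j))"
  unfolding kl_def by (simp add: sum.cartesian_product flip: UNIV_Times_UNIV) (intro sum.cong; auto)

text \<open>Exchanging the coordinates lets the row half steps reuse the lemmas stated for
  columns.\<close>

lemma kl_pair_swap:
  "kl (\<lambda>(i, j). Q i j) (\<lambda>(i, j). P i j) = kl (\<lambda>(j, i). Q i j) (\<lambda>(j, i). P i j)"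
  unfolding kl_pair_eq by (rule sum.swap)

lemma sum_pair_UNIV:
  "(\<Sum>x\<in>UNIV. case x of (i, j) \<Rightarrow> P i j) = (\<Sum>i\<in>UNIV. \<Sum>j\<in>UNIV. P i j)"
  by (simp add: sum.cartesian_product)

text \<open>
  The sum of \<open>kl Q P\<close> and \<open>kl P Q \<ge> 0\<close> only sees the difference of the second marginals,
  paired with \<open>ln g\<close>.
\<close>

lemma kl_le_oscillation_mult_marginal_error:
  fixes P Q :: "'i::finite \<Rightarrow> 'j::finite \<Rightarrow> real"
  assumes P: "\<And>i j. P i j > 0" and f: "\<And>i. f i > 0" and g: "\<And>j. g j > 0"
    and Q: "\<And>i j. Q i j = P i j * f i * g j"
    and rows: "\<And>i. (\<Sum>j\<in>UNIV. Q i j) = (\<Sum>j\<in>UNIV. P i j)"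
    and osc: "\<And>j l. ln (g j) - ln (g l) \<le> L"
  shows "kl (\<lambda>(i, j). Q i j) (\<lambda>(i, j). P i j)
    \<le> L / 2 * (\<Sum>j\<in>UNIV. \<bar>(\<Sum>i\<in>UNIV. Q i j) - (\<Sum>i\<in>UNIV. P i j)\<bar>)"
proof -
  have Qpos: "Q i j > 0" for i j using P f g by (simp add: Q)
  have ln1: "ln (Q i j / P i j) = ln (f i) + ln (g j)" for i j
    using P[of i j] f[of i] g[of j] by (simp add: Q ln_mult_pos)
  have ln2: "P i j * ln (P i j / Q i j) = - (P i j * (ln (f i) + ln (g j)))" for i j
  proof -
    have "ln (P i j / Q i j) = - (ln (f i) + ln (g j))"
      using ln1[of i j] P[of i j] Qpos[of i j] by (simp add: ln_divide_pos)
    then show ?thesis by (simp only: mult_minus_right)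
  qed
  have "0 \<le> kl (\<lambda>(i, j). P i j) (\<lambda>(i, j). Q i j)"
    using P Qpos rows by (intro kl_nonneg) (auto simp: sum_pair_UNIV less_imp_le)
  then have "kl (\<lambda>(i, j). Q i j) (\<lambda>(i, j). P i j)
      \<le> (\<Sum>i\<in>UNIV. \<Sum>j\<in>UNIV. Q i j * (ln (f i) + ln (g j))) - (\<Sum>i\<in>UNIV. \<Sum>j\<in>UNIV. P i j * (ln (f i) + ln (g j)))"
    by (simp only: kl_pair_eq ln1 ln2 sum_negf)
  also have "\<dots> = (\<Sum>i\<in>UNIV. \<Sum>j\<in>UNIV. (Q i j - P i j) * ln (f i)) + (\<Sum>i\<in>UNIV. \<Sum>j\<in>UNIV. (Q i j - P i j) * ln (g j))"
    by (simp add: sum_subtractf[symmetric] sum.distrib[symmetric] algebra_simps)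
  also have "(\<Sum>i\<in>UNIV. \<Sum>j\<in>UNIV. (Q i j - P i j) * ln (f i)) = 0"
    by (simp add: sum_distrib_right[symmetric] sum_subtractf rows)
  also have "(\<Sum>i\<in>UNIV. \<Sum>j\<in>UNIV. (Q i j - P i j) * ln (g j))
      = (\<Sum>j\<in>UNIV. ((\<Sum>i\<in>UNIV. Q i j) - (\<Sum>i\<in>UNIV. P i j)) * ln (g j))"
    by (subst sum.swap) (simp add: sum_distrib_right[symmetric] sum_subtractf)
  also have "\<dots> \<le> L / 2 * (\<Sum>j\<in>UNIV. \<bar>(\<Sum>i\<in>UNIV. Q i j) - (\<Sum>i\<in>UNIV. P i j)\<bar>)"
  proof (rule sum_diff_mult_le_oscillation)
    show "(\<Sum>j\<in>UNIV. \<Sum>i\<in>UNIV. Q i j) = (\<Sum>j\<in>UNIV. \<Sum>i\<in>UNIV. P i j)"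
      by (subst (1 2) sum.swap) (simp add: rows)
  qed (rule osc)
  finally show ?thesis by simp
qed

lemma kl_rescale:
  fixes P Q :: "'i::finite \<Rightarrow> 'j::finite \<Rightarrow> real"
  assumes P: "\<And>i j. P i j > 0" and Q: "\<And>i j. Q i j > 0"
    and P': "\<And>i j. P' i j = P i j * h j" and h: "\<And>j. h j > 0"
  shows "kl (\<lambda>(i, j). Q i j) (\<lambda>(i, j). P' i j)
    = kl (\<lambda>(i, j). Q i j) (\<lambda>(i, j). P i j) - (\<Sum>j\<in>UNIV. (\<Sum>i\<in>UNIV. Q i j) * ln (h j))"
proof -
  have "Q i j * ln (Q i j / P' i j) = Q i j * ln (Q i j / P i j) - Q i j * ln (h j)" for i j
    using P[of i j] Q[of i j] h[of j]
    by (simp add: P' ln_divide_pos ln_mult_pos algebra_simps)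
  then have "kl (\<lambda>(i, j). Q i j) (\<lambda>(i, j). P' i j)
      = kl (\<lambda>(i, j). Q i j) (\<lambda>(i, j). P i j) - (\<Sum>i\<in>UNIV. \<Sum>j\<in>UNIV. Q i j * ln (h j))"
    by (simp add: kl_pair_eq sum_subtractf)
  also have "(\<Sum>i\<in>UNIV. \<Sum>j\<in>UNIV. Q i j * ln (h j)) = (\<Sum>j\<in>UNIV. (\<Sum>i\<in>UNIV. Q i j) * ln (h j))"
    by (subst sum.swap) (simp add: sum_distrib_right)
  finally show ?thesis .
qed

text \<open>When the columns are rescaled to those of \<open>Q\<close>, the decrease is exactly the
  relative entropy between the two column marginals, which Pinsker's inequality bounds from
  below.\<close>

lemma kl_rescale_le:
  fixes P Q :: "'i::finite \<Rightarrow> 'j::finite \<Rightarrow> real"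
  assumes P: "\<And>i j. P i j > 0" and Q: "\<And>i j. Q i j > 0"
    and P': "\<And>i j. P' i j = P i j * ((\<Sum>i\<in>UNIV. Q i j) / (\<Sum>i\<in>UNIV. P i j))"
    and mass: "(\<Sum>i\<in>UNIV. \<Sum>j\<in>UNIV. P i j) = 1" "(\<Sum>i\<in>UNIV. \<Sum>j\<in>UNIV. Q i j) = 1"
  shows "kl (\<lambda>(i, j). Q i j) (\<lambda>(i, j). P' i j)
    \<le> kl (\<lambda>(i, j). Q i j) (\<lambda>(i, j). P i j)
      - (\<Sum>j\<in>UNIV. \<bar>(\<Sum>i\<in>UNIV. Q i j) - (\<Sum>i\<in>UNIV. P i j)\<bar>)\<^sup>2 / 2"
proof -
  have pos: "(\<Sum>i\<in>UNIV. Q i j) > 0" "(\<Sum>i\<in>UNIV. P i j) > 0" for j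
    using P Q by (auto intro!: sum_pos)
  have "kl (\<lambda>(i, j). Q i j) (\<lambda>(i, j). P' i j)
    = kl (\<lambda>(i, j). Q i j) (\<lambda>(i, j). P i j)
      - kl (\<lambda>j. \<Sum>i\<in>UNIV. Q i j) (\<lambda>j. \<Sum>i\<in>UNIV. P i j)"
    unfolding kl_def[of "\<lambda>j. \<Sum>i\<in>UNIV. Q i j"]
    using pos by (intro kl_rescale P Q P') auto
  moreover have "(\<Sum>j\<in>UNIV. \<bar>(\<Sum>i\<in>UNIV. Q i j) - (\<Sum>i\<in>UNIV. P i j)\<bar>)\<^sup>2 / 2
      \<le> kl (\<lambda>j. \<Sum>i\<in>UNIV. Q i j) (\<lambda>j. \<Sum>i\<in>UNIV. P i j)"
  proof (rule pinsker)
    show "(\<Sum>j\<in>UNIV. \<Sum>i\<in>UNIV. Q i j) = 1" "(\<Sum>j\<in>UNIV. \<Sum>i\<in>UNIV. P i j) = 1"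
      using mass by (subst sum.swap, simp)+
  qed (use pos in auto)
  ultimately show ?thesis by linarith
qed

text \<open>Both sides are compared with the sum of \<open>P i j * abs (h j - 1)\<close>: it
  dominates the row change by the triangle inequality and equals the column change, as
  \<open>h\<close> depends on \<open>j\<close> alone.\<close>

lemma rescale_marginal_error_le:
  fixes P :: "'i::finite \<Rightarrow> 'j::finite \<Rightarrow> real"
  assumes P: "\<And>i j. P i j \<ge> 0" and P': "\<And>i j. P' i j = P i j * h j"
  shows "(\<Sum>i\<in>UNIV. \<bar>(\<Sum>j\<in>UNIV. P i j) - (\<Sum>j\<in>UNIV. P' i j)\<bar>)
    \<le> (\<Sum>j\<in>UNIV. \<bar>(\<Sum>i\<in>UNIV. P' i j) - (\<Sum>i\<in>UNIV. P i j)\<bar>)"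
proof -
  have "(\<Sum>i\<in>UNIV. \<bar>(\<Sum>j\<in>UNIV. P i j) - (\<Sum>j\<in>UNIV. P' i j)\<bar>) \<le> (\<Sum>i\<in>UNIV. \<Sum>j\<in>UNIV. P i j * \<bar>h j - 1\<bar>)"
  proof (rule sum_mono)
    fix i
    have "\<bar>(\<Sum>j\<in>UNIV. P i j) - (\<Sum>j\<in>UNIV. P' i j)\<bar> \<le> (\<Sum>j\<in>UNIV. \<bar>P i j - P' i j\<bar>)"
      unfolding sum_subtractf[symmetric] by (rule sum_abs)
    also have "\<dots> = (\<Sum>j\<in>UNIV. P i j * \<bar>h j - 1\<bar>)"
    proof (rule sum.cong[OF refl])
      fix j
      have "P i j - P' i j = P i j * (1 - h j)" by (simp add: P' algebra_simps)
      then show "\<bar>P i j - P' i j\<bar> = P i j * \<bar>h j - 1\<bar>"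
        using P[of i j] by (simp add: abs_mult abs_minus_commute)
    qed
    finally show "\<bar>(\<Sum>j\<in>UNIV. P i j) - (\<Sum>j\<in>UNIV. P' i j)\<bar> \<le> (\<Sum>j\<in>UNIV. P i j * \<bar>h j - 1\<bar>)" .
  qed
  also have "\<dots> = (\<Sum>j\<in>UNIV. \<bar>(\<Sum>i\<in>UNIV. P' i j) - (\<Sum>i\<in>UNIV. P i j)\<bar>)"
  proof (subst sum.swap, rule sum.cong[OF refl])
    fix j
    have "(\<Sum>i\<in>UNIV. P' i j) - (\<Sum>i\<in>UNIV. P i j) = (\<Sum>i\<in>UNIV. P i j) * (h j - 1)"
      by (simp add: P' sum_distrib_right right_diff_distrib)
    then show "(\<Sum>i\<in>UNIV. P i j * \<bar>h j - 1\<bar>) = \<bar>(\<Sum>i\<in>UNIV. P' i j) - (\<Sum>i\<in>UNIV. P i j)\<bar>"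
      using P by (simp add: abs_mult sum_nonneg sum_distrib_right[symmetric])
  qed
  finally show ?thesis .
qed

section \<open>Sinkhorn's iteration\<close>

locale sinkhorn =
  fixes a :: "real ^ 'm" and b :: "real ^ 'n" and K :: "real ^ 'n ^ 'm"
  assumes a_pos: "\<And>i. a $ i > 0" and b_pos: "\<And>j. b $ j > 0" and K_pos: "\<And>i j. K $ i $ j > 0"
    and sum_a: "(\<Sum>i\<in>UNIV. a $ i) = 1" and sum_b: "(\<Sum>j\<in>UNIV. b $ j) = 1"
begin

lemma Kt_pos: "transpose K $ j $ i > 0"
  by (simp add: transpose_def K_pos)

lemma K_mult_pos: "(\<And>j. x $ j > 0) \<Longrightarrow> (K *v x) $ i > 0"
  by (rule matrix_vector_mult_pos) (auto simp: K_pos)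

lemma Kt_mult_pos: "(\<And>i. x $ i > 0) \<Longrightarrow> (transpose K *v x) $ j > 0"
  by (rule matrix_vector_mult_pos) (auto simp: Kt_pos)

text \<open>
  Indices start at 0: \<open>u k\<close>, \<open>v k\<close>, \<open>c k\<close> and \<open>P k\<close> belong to iteration \<open>k + 1\<close>. The
  matrix \<open>P' k\<close> is the state halfway between iterations \<open>k + 1\<close> and \<open>k + 2\<close>.
\<close>

definition u :: "nat \<Rightarrow> real ^ 'm" where "u k = sinkhorn_u a b K (Suc k)"
definition v :: "nat \<Rightarrow> real ^ 'n" where "v k = sinkhorn_v a b K (Suc k)"
definition c :: "nat \<Rightarrow> real ^ 'n" where "c k = column_sums (sinkhorn_matrix a b K (Suc k))"

lemma u_eq: "u k = a \<oslash> (K *v v k)" and v_Suc: "v (Suc k) = b \<oslash> (transpose K *v u k)"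
  by (simp_all add: u_def v_def sinkhorn_v_def)

lemma u_pos: "u k $ i > 0" and v_pos: "v k $ j > 0"
proof -
  have *: "sinkhorn_u a b K k $ i > 0" for k i
    by (induction k arbitrary: i)
      (auto simp: vec_divide_def a_pos b_pos intro!: K_mult_pos Kt_mult_pos divide_pos_pos)
  then show "u k $ i > 0" by (simp only: u_def)
  show "v k $ j > 0" 
    using * by (auto simp: v_def sinkhorn_v_def vec_divide_def b_pos intro!: Kt_mult_pos divide_pos_pos)
qed

definition P :: "nat \<Rightarrow> 'm \<Rightarrow> 'n \<Rightarrow> real" where "P k i j = u k $ i * K $ i $ j * v k $ j"
definition P' :: "nat \<Rightarrow> 'm \<Rightarrow> 'n \<Rightarrow> real" where "P' k i j = u k $ i * K $ i $ j * v (Suc k) $ j"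

lemma P_pos: "P k i j > 0" and P'_pos: "P' k i j > 0"
  by (simp_all add: P_def P'_def u_pos v_pos K_pos)

lemma diag_matrix_mult_diag_matrix:
  "(diag_matrix x ** M ** diag_matrix y) $ i $ j = x $ i * M $ i $ j * y $ j"
  by (simp add: matrix_matrix_mult_def diag_matrix_def if_distrib if_distribR sum.delta' cong: if_cong)

lemma sinkhorn_matrix_Suc: "sinkhorn_matrix a b K (Suc k) $ i $ j = P k i j"
  by (simp add: sinkhorn_matrix_def diag_matrix_mult_diag_matrix P_def u_def v_def)

lemma c_eq: "c k $ j = (\<Sum>i\<in>UNIV. P k i j)"
  by (simp add: c_def column_sums_def matrix_vector_mult_def transpose_def sinkhorn_matrix_Suc)

lemma sum_scaled_row: "(\<Sum>j\<in>UNIV. x $ i * K $ i $ j * y $ j) = x $ i * (K *v y) $ i"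
  by (simp add: matrix_vector_mult_def sum_distrib_left mult.assoc)

lemma sum_scaled_column: "(\<Sum>i\<in>UNIV. x $ i * K $ i $ j * y $ j) = y $ j * (transpose K *v x) $ j"
  by (simp add: matrix_vector_mult_def transpose_def sum_distrib_left mult_ac)

lemma P_rows: "(\<Sum>j\<in>UNIV. P k i j) = a $ i"
  unfolding P_def sum_scaled_row using K_mult_pos[of "v k" i] v_pos
  by (simp add: u_eq vec_divide_def)

lemma P'_columns: "(\<Sum>i\<in>UNIV. P' k i j) = b $ j"
  unfolding P'_def sum_scaled_column using Kt_mult_pos[of "u k" j] u_pos
  by (simp add: v_Suc vec_divide_def)

lemma c_pos: "c k $ j > 0"
  by (auto simp: c_eq P_pos intro!: sum_pos)

lemma sum_c: "(\<Sum>j\<in>UNIV. c k $ j) = 1"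
  unfolding c_eq by (subst sum.swap) (simp add: P_rows sum_a)

lemma c_eq_mult: "c k $ j = v k $ j * (transpose K *v u k) $ j"
  by (simp add: c_eq P_def sum_scaled_column)

lemma P'_eq: "P' k i j = P k i j * (b $ j / c k $ j)"
  using v_pos[of k j] Kt_mult_pos[of "u k" j] u_pos
  by (simp add: P'_def P_def c_eq_mult v_Suc vec_divide_def)

lemma P_Suc: "P (Suc k) i j = P' k i j * (a $ i / (\<Sum>j\<in>UNIV. P' k i j))"
proof -
  have "u k $ i > 0" "(K *v v (Suc k)) $ i > 0" by (auto intro: K_mult_pos u_pos v_pos)
  then show ?thesis
    unfolding P'_def sum_scaled_row by (simp add: P_def u_eq[of "Suc k"] vec_divide_def)
qed

text \<open>The next update multiplies \<open>v k\<close> by the ratio of \<open>b\<close> to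
  \<open>c k\<close>, so the column error is the length of the step from \<open>v k\<close> to
  \<open>v (Suc k)\<close>, to which contraction applies.\<close>

lemma hilbert_dist_c: "hilbert_dist (c k) b = hilbert_dist (v k) (v (Suc k))"
proof (rule hilbert_dist_ratio_cong)
  fix j
  show "c k $ j / b $ j = v k $ j / v (Suc k) $ j"
    using v_pos[of k j] Kt_mult_pos[of "u k" j] u_pos b_pos[of j]
    by (simp add: c_eq_mult v_Suc vec_divide_def)
qed

abbreviation \<Lambda> :: real where "\<Lambda> \<equiv> kernel_lambda K"

lemma lambda_nonneg: "\<Lambda> \<ge> 0" and lambda_less_1: "\<Lambda> < 1"
  by (rule kernel_lambda_bounds, rule K_pos)+

lemma u_step_contraction:
  assumes "\<And>j. x $ j > 0" "\<And>j. y $ j > 0"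
  shows "hilbert_dist (a \<oslash> (K *v x)) (a \<oslash> (K *v y)) \<le> \<Lambda> * hilbert_dist x y"
  using birkhoff_contraction[OF K_pos, of x y] assms K_mult_pos a_pos
  by (simp add: hilbert_dist_vec_divide)

lemma v_step_contraction:
  assumes "\<And>j. x $ j > 0" "\<And>j. y $ j > 0"
  shows "hilbert_dist (b \<oslash> (transpose K *v x)) (b \<oslash> (transpose K *v y)) \<le> \<Lambda> * hilbert_dist x y"
  using birkhoff_contraction[OF Kt_pos, of x y] assms Kt_mult_pos b_pos
  by (simp add: hilbert_dist_vec_divide kernel_lambda_transpose)

lemma full_step_contraction:
  assumes "\<And>j. x $ j > 0" "\<And>j. y $ j > 0"
  shows "hilbert_dist (b \<oslash> (transpose K *v (a \<oslash> (K *v x)))) (b \<oslash> (transpose K *v (a \<oslash> (K *v y))))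
    \<le> \<Lambda>\<^sup>2 * hilbert_dist x y"
proof -
  have "hilbert_dist (b \<oslash> (transpose K *v (a \<oslash> (K *v x)))) (b \<oslash> (transpose K *v (a \<oslash> (K *v y))))
    \<le> \<Lambda> * hilbert_dist (a \<oslash> (K *v x)) (a \<oslash> (K *v y))"
    using assms K_mult_pos a_pos by (intro v_step_contraction) (auto simp: vec_divide_def)
  also have "\<dots> \<le> \<Lambda> * (\<Lambda> * hilbert_dist x y)"
    by (intro mult_left_mono u_step_contraction assms lambda_nonneg)
  finally show ?thesis by (simp add: power2_eq_square mult.assoc)
qed

lemma hilbert_dist_c_Suc_le: "hilbert_dist (c (Suc k)) b \<le> \<Lambda>\<^sup>2 * hilbert_dist (c k) b"
  unfolding hilbert_dist_c using full_step_contraction[OF v_pos v_pos, of k "Suc k"]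
  by (simp only: u_eq[symmetric] v_Suc[symmetric])

lemma hilbert_dist_c_le_power: "hilbert_dist (c k) b \<le> \<Lambda> ^ (2 * k) * hilbert_dist (c 0) b"
proof (induction k)
  case (Suc k)
  have "hilbert_dist (c (Suc k)) b \<le> \<Lambda>\<^sup>2 * hilbert_dist (c k) b" by (rule hilbert_dist_c_Suc_le)
  also have "\<dots> \<le> \<Lambda>\<^sup>2 * (\<Lambda> ^ (2 * k) * hilbert_dist (c 0) b)"
    by (intro mult_left_mono Suc.IH) simp
  finally show ?case by (simp add: power2_eq_square mult.assoc)
qed simp

end

locale sinkhorn_scaling = sinkhorn a b K for a :: "real ^ 'm" and b :: "real ^ 'n" and K +
  fixes us :: "real ^ 'm" and vs :: "real ^ 'n"
  assumes us_pos: "\<And>i. us $ i > 0" and vs_pos: "\<And>j. vs $ j > 0"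
    and us_eq: "us = a \<oslash> (K *v vs)" and vs_eq: "vs = b \<oslash> (transpose K *v us)"
begin

definition Q :: "'m \<Rightarrow> 'n \<Rightarrow> real" where "Q i j = us $ i * K $ i $ j * vs $ j"

lemma Q_pos: "Q i j > 0"
  by (simp add: Q_def us_pos vs_pos K_pos)

lemma Q_rows: "(\<Sum>j\<in>UNIV. Q i j) = a $ i"
  unfolding Q_def sum_scaled_row using K_mult_pos[of vs i] vs_pos
  by (subst us_eq) (simp add: vec_divide_def)

lemma Q_columns: "(\<Sum>i\<in>UNIV. Q i j) = b $ j"
  unfolding Q_def sum_scaled_column using Kt_mult_pos[of us j] us_pos
  by (subst vs_eq) (simp add: vec_divide_def)

lemma mass: "(\<Sum>i\<in>UNIV. \<Sum>j\<in>UNIV. Q i j) = 1" "(\<Sum>i\<in>UNIV. \<Sum>j\<in>UNIV. P k i j) = 1"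
    "(\<Sum>i\<in>UNIV. \<Sum>j\<in>UNIV. P' k i j) = 1"
  by (simp add: Q_rows sum_a, simp add: P_rows sum_a, subst sum.swap, simp add: P'_columns sum_b)

text \<open>Passing through \<open>v (Suc k)\<close>, the contraction towards the fixed point
  \<open>vs\<close> gives \<open>(1 - \<Lambda>\<^sup>2) * hilbert_dist (v k) vs \<le> hilbert_dist
  (c k) b\<close>. Adding the distance of \<open>u k\<close> costs at most a factor
  \<open>1 + \<Lambda>\<close>, which cancels.\<close>

lemma hilbert_dist_scalings_le:
  "hilbert_dist (u k) us + hilbert_dist (v k) vs \<le> hilbert_dist (c k) b / (1 - \<Lambda>)"
proof -
  let ?d = "hilbert_dist (v k) vs"
  have "?d \<le> hilbert_dist (v k) (v (Suc k)) + hilbert_dist (v (Suc k)) vs"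
    by (rule hilbert_dist_triangle) (rule v_pos vs_pos)+
  also have "hilbert_dist (v (Suc k)) vs \<le> \<Lambda>\<^sup>2 * ?d"
    using full_step_contraction[OF v_pos vs_pos, of k]
    by (simp only: u_eq[symmetric] v_Suc[symmetric] us_eq[symmetric] vs_eq[symmetric])
  finally have "(1 - \<Lambda>\<^sup>2) * ?d \<le> hilbert_dist (c k) b"
    by (simp add: hilbert_dist_c algebra_simps)
  then have *: "(1 + \<Lambda>) * ?d * (1 - \<Lambda>) \<le> hilbert_dist (c k) b"
    by (simp add: power2_eq_square algebra_simps)
  have "hilbert_dist (u k) us + ?d \<le> (1 + \<Lambda>) * ?d"
    using u_step_contraction[OF v_pos vs_pos, of k]
    by (simp add: u_eq[symmetric] us_eq[symmetric] algebra_simps)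
  also have "\<dots> \<le> hilbert_dist (c k) b / (1 - \<Lambda>)"
    using * lambda_less_1 by (simp add: pos_le_divide_eq)
  finally show ?thesis .
qed

text \<open>
  Both matrices have total mass 1, so that their entrywise ratio is at most 1 somewhere and at
  least 1 somewhere; the bound on the oscillation of its logarithm then bounds the ratio itself.
\<close>

lemma abs_P_minus_Q_less:
  assumes d: "hilbert_dist (c k) b \<le> \<delta> * (1 - \<Lambda>)" and \<delta>: "\<delta> > 0"
  shows "\<bar>P k i j - Q i j\<bar> < exp \<delta> - 1"
proof -
  have "hilbert_dist (u k) us + hilbert_dist (v k) vs \<le> hilbert_dist (c k) b / (1 - \<Lambda>)"
    by (rule hilbert_dist_scalings_le)
  also have "\<dots> \<le> \<delta>" using d lambda_less_1 by (simp add: pos_divide_le_eq)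
  finally have D: "hilbert_dist (u k) us + hilbert_dist (v k) vs \<le> \<delta>" .
  define r where "r i j = ln (P k i j) - ln (Q i j)" for i j
  have r: "r i j = ln (u k $ i / us $ i) + ln (v k $ j / vs $ j)" for i j
    using u_pos[of k i] us_pos[of i] v_pos[of k j] vs_pos[of j] K_pos[of i j]
    by (simp add: r_def P_def Q_def ln_mult_pos ln_divide_pos)
  have osc: "r i j - r i' j' \<le> \<delta>" for i j i' j'
    using ln_ratio_diff_le_hilbert_dist[of "u k" us i i', OF u_pos us_pos]
      ln_ratio_diff_le_hilbert_dist[of "v k" vs j j', OF v_pos vs_pos] D by (simp add: r)
  have "\<exists>i j. P k i j \<le> Q i j"
  proof (rule ccontr)
    assume "\<not> ?thesis"
    then have "(\<Sum>i\<in>UNIV. \<Sum>j\<in>UNIV. Q i j) < (\<Sum>i\<in>UNIV. \<Sum>j\<in>UNIV. P k i j)"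
      by (intro sum_strict_mono) (auto simp: not_le)
    then show False by (simp add: mass)
  qed
  then obtain i1 j1 where "P k i1 j1 \<le> Q i1 j1" by blast
  then have "r i1 j1 \<le> 0" using P_pos Q_pos by (simp add: r_def)
  then have up: "r i j \<le> \<delta>" using osc[of i j i1 j1] by simp
  have "\<exists>i j. Q i j \<le> P k i j"
  proof (rule ccontr)
    assume "\<not> ?thesis"
    then have "(\<Sum>i\<in>UNIV. \<Sum>j\<in>UNIV. P k i j) < (\<Sum>i\<in>UNIV. \<Sum>j\<in>UNIV. Q i j)"
      by (intro sum_strict_mono) (auto simp: not_le)
    then show False by (simp add: mass)
  qed
  then obtain i2 j2 where "Q i2 j2 \<le> P k i2 j2" by blast
  then have "r i2 j2 \<ge> 0" using P_pos Q_pos by (simp add: r_def)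
  then have lo: "- r i j \<le> \<delta>" using osc[of i2 j2 i j] by simp
  \<comment> \<open>Entries are at most 1, so the ratio bound gives a difference of at most
    \<open>1 - exp (- \<delta>)\<close>, which is strictly below \<open>exp \<delta> - 1\<close>.
    This is the source of the strict inequality.\<close>
  have one: "y - x < exp \<delta> - 1" if "0 < x" "0 < y" "y \<le> 1" "ln y - ln x \<le> \<delta>" for x y :: real
  proof -
    have "ln y \<le> ln (exp \<delta> * x)" using that by (simp add: ln_mult_pos)
    then have "exp (- \<delta>) * y \<le> x" using that by (simp add: exp_minus field_simps)
    then have "y - x \<le> y * (1 - exp (- \<delta>))" by (simp add: algebra_simps)
    also have "\<dots> \<le> 1 - exp (- \<delta>)" using that \<delta> by (simp add: mult_left_le_one_le)
    also have "\<dots> < exp \<delta> - 1"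
    proof -
      have "(exp \<delta> - 1) * (1 - exp (- \<delta>)) > 0" using \<delta> by (intro mult_pos_pos) auto
      then show ?thesis by (simp add: algebra_simps flip: exp_add)
    qed
    finally show ?thesis .
  qed
  have le1: "P k i j \<le> 1" "Q i j \<le> 1"
  proof -
    have *: "R i j \<le> 1" if "\<And>i j. R i j > 0" "(\<Sum>i\<in>UNIV. \<Sum>j\<in>UNIV. R i j) = 1" for R :: "'m \<Rightarrow> 'n \<Rightarrow> real"
    proof -
      have "R i j \<le> (\<Sum>j\<in>UNIV. R i j)" using that(1) by (intro member_le_sum) (auto intro: less_imp_le)
      also have "\<dots> \<le> (\<Sum>i\<in>UNIV. \<Sum>j\<in>UNIV. R i j)"
        using that(1) by (intro member_le_sum[of i UNIV "\<lambda>i. \<Sum>j\<in>UNIV. R i j"]) (auto intro: sum_nonneg less_imp_le)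
      finally show ?thesis using that by simp
    qed
    show "P k i j \<le> 1" "Q i j \<le> 1" using P_pos Q_pos mass by (auto intro!: *)
  qed
  show ?thesis
    using one[of "Q i j" "P k i j"] one[of "P k i j" "Q i j"] up lo le1 P_pos Q_pos
    by (auto simp: r_def abs_less_iff)
qed

text \<open>The constant \<open>B\<close> of \<open>alternating_decrease_bound\<close> is half of
  \<open>ln (kernel_eta K)\<close> for every \<open>k\<close>: current and optimal scalings are
  images of positive vectors under the same update, so their Hilbert distance is at most
  \<open>ln (kernel_eta K)\<close>.\<close>

lemma column_error_le:
  assumes g: "g > 0" and n: "ln (kernel_eta K) / g \<le> real n"
  shows "(\<Sum>j\<in>UNIV. \<bar>b $ j - c n $ j\<bar>) \<le> g"
proof -
  let ?KL = "\<lambda>R. kl (\<lambda>(i, j). Q i j) (\<lambda>(i, j). R i j)"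
  define r where "r k i = (\<Sum>j\<in>UNIV. P' k i j)" for k i
  define E where "E k = (\<Sum>j\<in>UNIV. \<bar>b $ j - c k $ j\<bar>)" for k
  define E' where "E' k = (\<Sum>i\<in>UNIV. \<bar>a $ i - r k i\<bar>)" for k
  have lnr: "ln (z $ i / x $ i) - ln (z $ l / x $ l) \<le> hilbert_dist z x"
    if "\<And>i. x $ i > 0" "\<And>i. z $ i > 0" for x z :: "real ^ 'k::finite" and i l
    using that by (intro ln_ratio_diff_le_hilbert_dist)
  have "E n \<le> g"
  proof (rule alternating_decrease_bound[where D = "\<lambda>k. ?KL (P k)" and D' = "\<lambda>k. ?KL (P' k)"
        and E' = E' and B = "ln (kernel_eta K) / 2"])
    fix k
    show "?KL (P k) \<ge> 0" "?KL (P' k) \<ge> 0"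
      by (auto intro!: kl_nonneg simp: P_pos P'_pos Q_pos less_imp_le sum_pair_UNIV mass)
    show "E k \<ge> 0" by (auto simp: E_def intro: sum_nonneg)
    show "?KL (P k) \<le> ln (kernel_eta K) / 2 * E k"
      unfolding E_def c_eq Q_columns[symmetric]
    proof (rule kl_le_oscillation_mult_marginal_error[where f = "\<lambda>i. us $ i / u k $ i" and g = "\<lambda>j. vs $ j / v k $ j"])
      fix j l
      \<comment> \<open>The case \<open>k = 0\<close> is included, since \<open>v 0\<close> is the
        update of the uniform initial vector.\<close>
      obtain x where x: "\<And>i. x $ i > 0" "v k = b \<oslash> (transpose K *v x)"
      proof (cases k)
        case 0
        then show ?thesis using that[of "sinkhorn_u a b K 0"] by (auto simp: v_def sinkhorn_v_def)
      next
        case (Suc k')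
        then show ?thesis using that[of "u k'"] u_pos v_Suc by auto
      qed
      have "hilbert_dist vs (v k) = hilbert_dist (transpose K *v us) (transpose K *v x)"
        using x us_pos Kt_mult_pos b_pos by (subst vs_eq) (simp add: hilbert_dist_vec_divide)
      also have "\<dots> \<le> ln (kernel_eta K)"
        using hilbert_dist_matrix_vector_mult_le_ln_eta[OF Kt_pos us_pos x(1)] by (simp add: kernel_eta_transpose)
      finally show "ln (vs $ j / v k $ j) - ln (vs $ l / v k $ l) \<le> ln (kernel_eta K)"
        using lnr[of "v k" vs j l] v_pos vs_pos by auto
    next
      fix i j
      show "Q i j = P k i j * (us $ i / u k $ i) * (vs $ j / v k $ j)"
        using u_pos[of k i] v_pos[of k j] by (simp add: Q_def P_def)
    qed (auto simp: P_pos u_pos us_pos v_pos vs_pos Q_rows P_rows)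
    show "?KL (P' k) \<le> ln (kernel_eta K) / 2 * E' k"
      unfolding E'_def r_def Q_rows[symmetric]
    \<comment> \<open>Rows and columns change roles: \<open>P' k\<close> has the correct columns,
      and its error lies in the rows.\<close>
    proof (subst kl_pair_swap, rule kl_le_oscillation_mult_marginal_error[where P = "\<lambda>j i. P' k i j"
          and f = "\<lambda>j. vs $ j / v (Suc k) $ j" and g = "\<lambda>i. us $ i / u k $ i"])
      fix i l
      have "hilbert_dist us (u k) = hilbert_dist (K *v vs) (K *v v k)"
        unfolding u_eq using v_pos vs_pos K_mult_pos a_pos by (subst us_eq) (simp add: hilbert_dist_vec_divide)
      also have "\<dots> \<le> ln (kernel_eta K)"
        by (rule hilbert_dist_matrix_vector_mult_le_ln_eta[OF K_pos vs_pos v_pos])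
      finally show "ln (us $ i / u k $ i) - ln (us $ l / u k $ l) \<le> ln (kernel_eta K)"
        using lnr[of "u k" us i l] u_pos us_pos by auto
    next
      fix j i
      show "Q i j = P' k i j * (vs $ j / v (Suc k) $ j) * (us $ i / u k $ i)"
        using u_pos[of k i] v_pos[of "Suc k" j] by (simp add: Q_def P'_def)
    qed (auto simp: P'_pos u_pos us_pos v_pos vs_pos Q_columns P'_columns)
    show "?KL (P' k) \<le> ?KL (P k) - (E k)\<^sup>2 / 2"
      unfolding E_def c_eq Q_columns[symmetric]
      by (rule kl_rescale_le) (auto simp: P_pos Q_pos P'_eq c_eq Q_columns mass)
    show "?KL (P (Suc k)) \<le> ?KL (P' k) - (E' k)\<^sup>2 / 2"
      unfolding E'_def r_def Q_rows[symmetric] kl_pair_swap[of Q]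
    proof (rule kl_rescale_le)
      show "(\<Sum>j\<in>UNIV. \<Sum>i\<in>UNIV. P' k i j) = 1" "(\<Sum>j\<in>UNIV. \<Sum>i\<in>UNIV. Q i j) = 1"
        by (simp_all add: P'_columns Q_columns sum_b)
    qed (auto simp: P'_pos Q_pos P_Suc Q_rows)
    show "E' k \<le> E k"
      using rescale_marginal_error_le[where P = "P k" and P' = "P' k", OF less_imp_le[OF P_pos] P'_eq]
      by (simp add: E_def E'_def r_def c_eq P'_columns P_rows)
    show "E (Suc k) \<le> E' k"
      using rescale_marginal_error_le[where P = "\<lambda>j i. P' k i j" and P' = "\<lambda>j i. P (Suc k) i j", OF less_imp_le[OF P'_pos] P_Suc]
      by (simp add: E_def E'_def r_def c_eq P'_columns P_rows)
  next
    show "0 \<le> ln (kernel_eta K) / 2" using kernel_eta_ge_1[OF K_pos] by simp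
  qed (use g n in auto)
  then show ?thesis by (simp add: E_def)
qed

end

section \<open>Convergence rates\<close>

text \<open>By equal masses each coordinate differs by at most
  \<open>\<beta> * x \<le> x * q $ j\<close>. So every ratio of \<open>p\<close> to \<open>q\<close>
  lies between \<open>1 - x\<close> and \<open>1 + x\<close>, and its logarithm between
  \<open>- x / (1 - x)\<close> and \<open>x\<close>.\<close>

lemma hilbert_dist_le_if_sum_abs_diff_le:
  assumes p: "\<And>j. p $ j > 0" and q: "\<And>j. q $ j \<ge> \<beta>" and \<beta>: "\<beta> > 0"
    and eq: "(\<Sum>j\<in>UNIV. q $ j) = (\<Sum>j\<in>UNIV. p $ j)"
    and le: "(\<Sum>j\<in>UNIV. \<bar>q $ j - p $ j\<bar>) \<le> 2 * \<beta> * x" and x: "x < 1"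
  shows "hilbert_dist p q \<le> x + x / (1 - x)"
proof -
  have qpos: "q $ j > 0" for j using q[of j] \<beta> by linarith
  have "(\<Sum>j\<in>UNIV. \<bar>q $ j - p $ j\<bar>) \<ge> 0" by (intro sum_nonneg) auto
  then have "0 \<le> 2 * \<beta> * x" using le by linarith
  then have x0: "x \<ge> 0" using \<beta> by (simp add: zero_le_mult_iff)
  have abs: "\<bar>q $ j - p $ j\<bar> \<le> x * q $ j" for j
  proof -
    have "\<bar>q $ j - p $ j\<bar> \<le> \<beta> * x"
      using abs_diff_le_half_sum_abs_diff[OF eq, of j] le by simp
    also have "\<dots> \<le> x * q $ j" using q[of j] x0 by (subst mult.commute) (rule mult_left_mono)
    finally show ?thesis .
  qed
  have up: "ln (p $ j / q $ j) \<le> x" for j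
  proof -
    have "ln (p $ j / q $ j) \<le> p $ j / q $ j - 1" by (intro ln_le_minus_one divide_pos_pos p qpos)
    also have "\<dots> = (p $ j - q $ j) / q $ j" using qpos[of j] by (simp add: diff_divide_distrib)
    also have "\<dots> \<le> x" using abs[of j] qpos[of j] by (simp add: pos_divide_le_eq)
    finally show ?thesis .
  qed
  have lo: "- ln (p $ j / q $ j) \<le> x / (1 - x)" for j
  proof -
    have *: "(1 - x) * q $ j \<le> p $ j" using abs[of j] by (simp add: algebra_simps abs_le_iff)
    have "- ln (p $ j / q $ j) = ln (q $ j / p $ j)" using p[of j] qpos[of j] by (simp add: ln_divide_pos)
    also have "\<dots> \<le> q $ j / p $ j - 1" by (intro ln_le_minus_one divide_pos_pos p qpos)
    also have "q $ j / p $ j \<le> 1 / (1 - x)" using * x p[of j] by (simp add: field_simps)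
    also have "1 / (1 - x) - 1 = x / (1 - x)" using x by (simp add: field_simps)
    finally show ?thesis by simp
  qed
  have "ln (p $ i / q $ i) - ln (p $ j / q $ j) \<le> x + x / (1 - x)" for i j
    using up[of i] lo[of j] by linarith
  then show ?thesis using p qpos by (simp add: hilbert_dist_le_iff)
qed

text \<open>The constant in the potential bound is the root in \<open>(0, 1)\<close> of \<open>x + x / (1 - x) = s\<close>.\<close>

lemma smaller_root:
  fixes s :: real
  assumes s: "s > 0" and x: "x = (s + 2 - sqrt (s\<^sup>2 + 4)) / 2"
  shows "0 < x" "x < 1" "x + x / (1 - x) = s"
proof -
  have sq: "(sqrt (s\<^sup>2 + 4))\<^sup>2 = s\<^sup>2 + 4" by simp
  have "s\<^sup>2 + 4 < (s + 2)\<^sup>2" using s by (simp add: power2_eq_square algebra_simps)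
  then have "sqrt (s\<^sup>2 + 4) < s + 2" using s by (intro real_less_lsqrt) auto
  then show "0 < x" by (simp add: x)
  have "s < sqrt (s\<^sup>2 + 4)" by (rule real_less_rsqrt) simp
  then show x1: "x < 1" by (simp add: x)
  have "x * (1 - x) + x = s * (1 - x)"
    using sq unfolding x by (simp add: power2_eq_square field_simps)
  then show "x + x / (1 - x) = s" using x1 by (simp add: field_simps)
qed

section \<open>Gibbs kernels and the entrywise norm\<close>

lemma abs_le_entry_max_norm: "\<bar>M $ i $ j\<bar> \<le> entry_max_norm M"
  unfolding entry_max_norm_def by (rule Max_ge) (auto intro: range_eqI[of _ _ "(i, j)"])

lemma entry_max_norm_less_iff: "entry_max_norm M < r \<longleftrightarrow> (\<forall>i j. \<bar>M $ i $ j\<bar> < r)"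
  unfolding entry_max_norm_def by (subst Max_less_iff) auto

lemma gibbs_kernel_pos: "gibbs_kernel \<epsilon> C $ i $ j > 0"
  by (simp add: gibbs_kernel_def)

text \<open>A cross ratio involves four kernel entries, and each contributes at most
  \<open>entry_max_norm C / \<epsilon>\<close> to the exponent.\<close>

lemma ln_kernel_eta_gibbs_kernel_le:
  assumes "\<epsilon> > 0"
  shows "ln (kernel_eta (gibbs_kernel \<epsilon> C)) \<le> 4 * (entry_max_norm C / \<epsilon>)"
proof -
  have le: "- (C $ i $ j) / \<epsilon> \<le> entry_max_norm C / \<epsilon>" "C $ i $ j / \<epsilon> \<le> entry_max_norm C / \<epsilon>" for i j
    using abs_le_entry_max_norm[of C i j] assms by (auto intro!: divide_right_mono simp: abs_le_iff simp del: divide_minus_left minus_divide_left)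
  have "kernel_eta (gibbs_kernel \<epsilon> C) \<le> exp (4 * (entry_max_norm C / \<epsilon>))"
    unfolding kernel_eta_le_iff
  proof (intro allI)
    fix i j k l
    have "gibbs_kernel \<epsilon> C $ i $ k * gibbs_kernel \<epsilon> C $ j $ l / (gibbs_kernel \<epsilon> C $ j $ k * gibbs_kernel \<epsilon> C $ i $ l)
        = exp (- (C $ i $ k) / \<epsilon> + - (C $ j $ l) / \<epsilon> + C $ j $ k / \<epsilon> + C $ i $ l / \<epsilon>)"
      by (simp add: gibbs_kernel_def exp_add exp_diff exp_minus divide_inverse)
    also have "\<dots> \<le> exp (4 * (entry_max_norm C / \<epsilon>))"
      using le(1)[of i k] le(1)[of j l] le(2)[of j k] le(2)[of i l] by simp
    finally show "gibbs_kernel \<epsilon> C $ i $ k * gibbs_kernel \<epsilon> C $ j $ l / (gibbs_kernel \<epsilon> C $ j $ k * gibbs_kernel \<epsilon> C $ i $ l) 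
      \<le> exp (4 * (entry_max_norm C / \<epsilon>))" .
  qed
  moreover have "kernel_eta (gibbs_kernel \<epsilon> C) > 0"
    using kernel_eta_ge_1[of "gibbs_kernel \<epsilon> C"] gibbs_kernel_pos by (metis less_le_trans zero_less_one)
  ultimately have "ln (kernel_eta (gibbs_kernel \<epsilon> C)) \<le> ln (exp (4 * (entry_max_norm C / \<epsilon>)))"
    by (subst ln_le_cancel_iff) auto
  then show ?thesis by simp
qed

section \<open>Existence of optimal scalings, and the contraction rate\<close>

context sinkhorn
begin

text \<open>
  Brouwer's theorem gives a fixed point of \<open>v \<mapsto> b \<oslash> K\<^sup>T (a \<oslash> K v)\<close>, normalised to a self-map of
  the simplex. Comparing total masses shows that the normalising factor is 1.
\<close>

lemma exists_scaling:
  obtains us vs where "sinkhorn_scaling a b K us vs"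
proof -
  define S where "S = {w :: real ^ 'n. (\<forall>j. 0 \<le> w $ j) \<and> (\<Sum>j\<in>UNIV. w $ j) = 1}"
  define T where "T w = b \<oslash> (transpose K *v (a \<oslash> (K *v w)))" for w
  define f where "f w = (1 / (\<Sum>j\<in>UNIV. T w $ j)) *\<^sub>R T w" for w
  \<comment> \<open>A point of the simplex may have zero coordinates, but not only zeros, so a
    strictly positive kernel maps it to a positive vector.\<close>
  have Kw: "(K *v w) $ i > 0" if "w \<in> S" for w i
  proof -
    have "(K *v w) $ i \<ge> 0"
      using that K_pos by (auto simp: matrix_vector_mult_def S_def intro!: sum_nonneg mult_nonneg_nonneg less_imp_le[OF K_pos])
    moreover have "(K *v w) $ i \<noteq> 0"
    proof
      assume "(K *v w) $ i = 0"
      then have "\<forall>j. K $ i $ j * w $ j = 0"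
        using that K_pos by (simp add: matrix_vector_mult_def sum_nonneg_eq_0_iff S_def less_imp_le)
      then have "w = 0" using K_pos by (metis less_irrefl mult_eq_0_iff vec_eq_iff zero_index)
      then show False using that by (simp add: S_def)
    qed
    ultimately show ?thesis by simp
  qed
  have Ku: "(transpose K *v (a \<oslash> (K *v w))) $ j > 0" if "w \<in> S" for w j
    using Kw[OF that] a_pos by (intro Kt_mult_pos) (simp add: vec_divide_def)
  have Tpos: "T w $ j > 0" if "w \<in> S" for w j
    using Ku[OF that] b_pos by (simp add: T_def vec_divide_def)
  have sumT: "(\<Sum>j\<in>UNIV. T w $ j) > 0" if "w \<in> S" for w
    using Tpos[OF that] by (intro sum_pos) auto
  have "compact S"
  proof -
    have "S = (\<Inter>j. {w. 0 \<le> w $ j}) \<inter> {w. (\<Sum>j\<in>UNIV. w $ j) = 1}" by (auto simp: S_def)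
    then have "closed S"
      by (auto intro!: closed_INT closed_Int closed_Collect_le closed_Collect_eq continuous_intros)
    moreover have "S \<subseteq> cball 0 1"
    proof
      fix w assume "w \<in> S"
      then have "(\<Sum>j\<in>UNIV. \<bar>w $ j\<bar>) = 1" by (simp add: S_def)
      then show "w \<in> cball 0 1" using norm_le_l1_cart[of w] by simp
    qed
    ultimately show ?thesis using bounded_cball bounded_subset by (auto simp: compact_eq_bounded_closed)
  qed
  moreover have "convex S"
    by (rule convexI) (auto simp: S_def sum.distrib simp flip: sum_distrib_left)
  moreover have "S \<noteq> {}"
    using b_pos sum_b by (auto simp: S_def intro!: exI[of _ b] less_imp_le)
  moreover have "continuous_on S f"
  proof -
    have K1: "continuous_on S (\<lambda>w. a $ i / (K *v w) $ i)" for i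
      using Kw by (intro continuous_intros) (auto simp: less_imp_neq[symmetric] intro!: continuous_intros)
    have "continuous_on S (\<lambda>w. T w $ j)" for j
    proof -
      have eq: "(transpose K *v (a \<oslash> (K *v w))) $ j = (\<Sum>i\<in>UNIV. transpose K $ j $ i * (a $ i / (K *v w) $ i))" for w
        by (simp add: matrix_vector_mult_def[of "transpose K"] vec_divide_def)
      have "continuous_on S (\<lambda>w. (transpose K *v (a \<oslash> (K *v w))) $ j)"
        unfolding eq by (intro continuous_on_sum continuous_on_mult continuous_on_const K1)
      then have "continuous_on S (\<lambda>w. b $ j / (transpose K *v (a \<oslash> (K *v w))) $ j)"
        using Ku by (intro continuous_on_divide continuous_on_const) (auto simp: less_imp_neq[symmetric])
      then show ?thesis by (simp add: T_def vec_divide_def[of b])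
    qed
    then have "continuous_on S T" using continuous_on_vec_lambda[of S "\<lambda>j w. T w $ j"] by simp
    then show ?thesis
      unfolding f_def using sumT by (intro continuous_intros) (auto simp: less_imp_neq[symmetric])
  qed
  moreover have "f \<in> S \<rightarrow> S"
  proof
    fix w assume w: "w \<in> S"
    have "(\<Sum>j\<in>UNIV. f w $ j) = 1"
      using sumT[OF w] by (simp add: f_def flip: sum_divide_distrib)
    moreover have "f w $ j \<ge> 0" for j
      using sumT[OF w] Tpos[OF w, of j] by (simp add: f_def)
    ultimately show "f w \<in> S" by (simp add: S_def)
  qed
  ultimately obtain w where w: "w \<in> S" "f w = w" by (rule brouwer)
  define \<sigma> where "\<sigma> = (\<Sum>j\<in>UNIV. T w $ j)"
  define us where "us = a \<oslash> (K *v w)"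
  have \<sigma>: "\<sigma> > 0" using sumT[OF w(1)] by (simp add: \<sigma>_def)
  have Tw: "T w $ j = \<sigma> * w $ j" for j
    using arg_cong[OF w(2), of "\<lambda>w. w $ j"] \<sigma> by (simp add: f_def \<sigma>_def field_simps)
  \<comment> \<open>The fixed point is interior because \<open>T\<close> takes positive values on
    the whole simplex.\<close>
  have wpos: "w $ j > 0" for j using Tpos[OF w(1), of j] \<sigma> by (simp add: Tw zero_less_mult_iff)
  have uspos: "us $ i > 0" for i using Kw[OF w(1)] a_pos by (simp add: us_def vec_divide_def)
  \<comment> \<open>The entries \<open>us $ i * K $ i $ j * w $ j\<close> are summed by rows and
    then by columns.\<close>
  have "1 = (\<Sum>i\<in>UNIV. us $ i * (K *v w) $ i)"
    using Kw[OF w(1)] sum_a by (simp add: us_def vec_divide_def less_imp_neq[symmetric])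
  also have "\<dots> = (\<Sum>j\<in>UNIV. w $ j * (transpose K *v us) $ j)"
    unfolding sum_scaled_row[symmetric] sum_scaled_column[symmetric] by (rule sum.swap)
  also have "\<dots> = (\<Sum>j\<in>UNIV. b $ j / \<sigma>)"
  proof (rule sum.cong[OF refl])
    fix j
    show "w $ j * (transpose K *v us) $ j = b $ j / \<sigma>"
      using Tw[of j] Ku[OF w(1), of j] \<sigma> by (simp add: T_def us_def vec_divide_def field_simps)
  qed
  also have "\<dots> = 1 / \<sigma>" using sum_b by (simp flip: sum_divide_distrib)
  finally have "\<sigma> = 1" using \<sigma> by (simp add: field_simps)
  then have "w = b \<oslash> (transpose K *v us)"
    using Tw by (simp add: vec_eq_iff T_def us_def)
  then have "sinkhorn_scaling a b K us w"
    using wpos uspos by unfold_locales (auto simp: us_def)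
  then show ?thesis by (rule that)
qed

text \<open>Index \<open>n\<close> is iteration \<open>n + 1\<close>. For a nonzero initial error
  \<open>\<Delta>\<close>, the assumption is \<open>\<Lambda> ^ (2 * n) * \<Delta> \<le> \<delta> *
  (1 - \<Lambda>)\<close> solved for \<open>n\<close>.\<close>

lemma hilbert_dist_c_le_if_k_tilde_contraction_le:
  assumes \<delta>: "\<delta> > 0" and n: "k_tilde_contraction a b K \<delta> \<le> real (Suc n)"
  shows "hilbert_dist (c n) b \<le> \<delta> * (1 - \<Lambda>)"
proof -
  let ?\<Delta> = "hilbert_dist (c 0) b"
  have s: "\<delta> * (1 - \<Lambda>) > 0" using \<delta> lambda_less_1 by simp
  have \<Delta>: "?\<Delta> \<ge> 0" by (intro hilbert_dist_nonneg c_pos b_pos)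
  show ?thesis
  proof (cases "?\<Delta> = 0")
    case True
    then show ?thesis using hilbert_dist_c_le_power[of n] s by simp
  next
    case False
    \<comment> \<open>The first \<open>v\<close> is itself an update, so a nonzero initial error
      forces \<open>\<Lambda> > 0\<close>. Then \<open>ln \<Lambda>\<close> is negative, and
      multiplying by it reverses the inequality.\<close>
    have "?\<Delta> \<le> \<Lambda> * hilbert_dist (sinkhorn_u a b K 0) (u 0)"
      unfolding hilbert_dist_c
      using v_step_contraction[of "sinkhorn_u a b K 0" "u 0"] u_pos
      by (simp add: v_Suc) (simp add: v_def sinkhorn_v_def)
    then have l: "\<Lambda> > 0" using \<Delta> False lambda_nonneg by (cases "\<Lambda> = 0") auto
    have lnl: "ln \<Lambda> < 0" using l lambda_less_1 by simp
    have "1 / (2 * ln \<Lambda>) * ln (\<delta> * (1 - \<Lambda>) / ?\<Delta>) \<le> real n"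
      using n False by (simp add: k_tilde_contraction_def c_def Let_def)
    then have "real (2 * n) * ln \<Lambda> \<le> ln (\<delta> * (1 - \<Lambda>) / ?\<Delta>)"
      using lnl by (simp add: field_simps)
    then have "ln (\<Lambda> ^ (2 * n)) \<le> ln (\<delta> * (1 - \<Lambda>) / ?\<Delta>)"
      using l by (simp add: ln_realpow)
    then have "\<Lambda> ^ (2 * n) \<le> \<delta> * (1 - \<Lambda>) / ?\<Delta>"
      using l s \<Delta> False by (subst (asm) ln_le_cancel_iff) auto
    then have "\<Lambda> ^ (2 * n) * ?\<Delta> \<le> \<delta> * (1 - \<Lambda>)"
      using \<Delta> False by (simp add: field_simps)
    then show ?thesis using hilbert_dist_c_le_power[of n] by linarith
  qed
qed

end

section \<open>The potential rate, and the choice of the parameters\<close>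

context sinkhorn_scaling
begin

text \<open>A column error of at most \<open>2 * \<beta> * x\<close> suffices, because
  \<open>x\<close> solves \<open>x + x / (1 - x) = s\<close>. By \<open>column_error_le\<close> it
  is reached once \<open>n \<ge> ln (kernel_eta K) / (2 * \<beta> * x)\<close>; the Gibbs bound and
  \<open>m \<le> 1\<close> show that the assumed \<open>n\<close> is at least this large.\<close>

lemma hilbert_dist_c_le_if_k_tilde_potential_le:
  assumes \<epsilon>: "\<epsilon> > 0" and \<delta>: "\<delta> > 0" and K: "K = gibbs_kernel \<epsilon> C"
    and n: "k_tilde_potential a b C \<epsilon> \<delta> \<le> real (Suc n)"
  shows "hilbert_dist (c n) b \<le> \<delta> * (1 - \<Lambda>)"
proof -
  define s where "s = \<delta> * (1 - \<Lambda>)"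
  define \<beta> where "\<beta> = Min (range (\<lambda>j. b $ j))"
  define m where "m = Min (range (\<lambda>(i, j). min (a $ i) (b $ j)))"
  define x where "x = (s + 2 - sqrt (s\<^sup>2 + 4)) / 2"
  have s: "s > 0" using \<delta> lambda_less_1 by (simp add: s_def)
  note x = smaller_root[OF s x_def]
  have "\<beta> \<in> range (\<lambda>j. b $ j)" unfolding \<beta>_def by (rule Min_in) auto
  then have \<beta>: "\<beta> > 0" using b_pos by auto
  have b\<beta>: "b $ j \<ge> \<beta>" for j by (simp add: \<beta>_def)
  have "m \<in> range (\<lambda>(i, j). min (a $ i) (b $ j))" unfolding m_def by (rule Min_in) auto
  then obtain i j where m_eq: "m = min (a $ i) (b $ j)" by auto
  have m: "m > 0" "m \<le> 1"
  proof -
    show "m > 0" using a_pos b_pos by (simp add: m_eq)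
    have "a $ i \<le> (\<Sum>i\<in>UNIV. a $ i)" using a_pos by (intro member_le_sum) (auto intro: less_imp_le)
    then show "m \<le> 1" using sum_a by (simp add: m_eq min_le_iff_disj)
  qed
  have "k_tilde_potential a b C \<epsilon> \<delta> = 1 - 4 * inverse \<beta> / (2 * x) * (ln m - entry_max_norm C / \<epsilon>)"
  proof -
    have "ln (exp (- entry_max_norm C / \<epsilon>) * m) = ln m - entry_max_norm C / \<epsilon>"
      using m(1) by (simp add: ln_mult_pos)
    moreover have "2 * x = \<delta> * (1 - \<Lambda>) + 2 - sqrt (\<delta>\<^sup>2 * (1 - \<Lambda>)\<^sup>2 + 4)"
      by (simp add: x_def s_def power_mult_distrib)
    ultimately show ?thesis
      unfolding k_tilde_potential_def Let_def \<beta>_def[symmetric] m_def[symmetric] K[symmetric] by simp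
  qed
  then have "2 / (\<beta> * x) * (entry_max_norm C / \<epsilon> - ln m) \<le> real n"
  proof -
    have "4 * inverse \<beta> / (2 * x) * (ln m - entry_max_norm C / \<epsilon>)
        = - (2 / (\<beta> * x) * (entry_max_norm C / \<epsilon> - ln m))"
      using \<beta> x by (simp add: divide_simps)
    moreover have "k_tilde_potential a b C \<epsilon> \<delta> - 1 \<le> real n" using n by simp
    ultimately show ?thesis using \<open>k_tilde_potential a b C \<epsilon> \<delta> = _\<close> by linarith
  qed
  moreover have "2 / (\<beta> * x) * (entry_max_norm C / \<epsilon>) \<le> 2 / (\<beta> * x) * (entry_max_norm C / \<epsilon> - ln m)"
    using m \<beta> x by (intro mult_left_mono) auto
  moreover have "ln (kernel_eta K) / (2 * \<beta> * x) \<le> 4 * (entry_max_norm C / \<epsilon>) / (2 * \<beta> * x)"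
    unfolding K using \<beta> x \<epsilon> by (intro divide_right_mono ln_kernel_eta_gibbs_kernel_le) auto
  moreover have "4 * (entry_max_norm C / \<epsilon>) / (2 * \<beta> * x) = 2 / (\<beta> * x) * (entry_max_norm C / \<epsilon>)"
    by simp
  ultimately have "ln (kernel_eta K) / (2 * \<beta> * x) \<le> real n"
    by linarith
  then have "(\<Sum>j\<in>UNIV. \<bar>b $ j - c n $ j\<bar>) \<le> 2 * \<beta> * x"
    using \<beta> x by (intro column_error_le) auto
  then have "hilbert_dist (c n) b \<le> x + x / (1 - x)"
    using c_pos b\<beta> \<beta> x sum_b sum_c by (intro hilbert_dist_le_if_sum_abs_diff_le) auto
  then show ?thesis by (simp only: x s_def)
qed

lemma hilbert_dist_c_le_if_k_tilde_le:
  assumes "\<epsilon> > 0" "\<delta> > 0" "K = gibbs_kernel \<epsilon> C" "k_tilde a b C \<epsilon> \<delta> \<le> real (Suc n)"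
  shows "hilbert_dist (c n) b \<le> \<delta> * (1 - \<Lambda>)"
  using assms hilbert_dist_c_le_if_k_tilde_contraction_le hilbert_dist_c_le_if_k_tilde_potential_le
  by (auto simp: k_tilde_def min_le_iff_disj)

text \<open>
  For \<open>\<gamma>\<close> below all nonzero column errors of the first \<open>N\<close> iterations, the algorithm stops
  before iteration \<open>N\<close> only at an iterate with the exact marginals.
\<close>

lemma exists_threshold:
  assumes N: "N \<ge> 1" and d: "hilbert_dist (c (N - 1)) b \<le> s" and s: "s \<ge> 0"
  obtains \<gamma> k where "\<gamma> > 0" "sinkhorn_iterations a b K \<gamma> N = Suc k" "Suc k \<le> N" "hilbert_dist (c k) b \<le> s"
proof -
  define F where "F = {norm (c k - b) |k. k < N \<and> c k \<noteq> b}"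
  have F: "finite F" "\<And>r. r \<in> F \<Longrightarrow> r > 0" unfolding F_def by auto
  \<comment> \<open>Inserting 1 keeps the minimum defined and positive when no nonzero error
    occurs.\<close>
  define \<gamma> where "\<gamma> = Min (insert 1 F)"
  have \<gamma>: "\<gamma> > 0" using F by (auto simp: \<gamma>_def Min_gr_iff)
  have small: "c k = b" if "norm (c k - b) < \<gamma>" "k < N" for k
  proof (rule ccontr)
    assume "c k \<noteq> b"
    then have "norm (c k - b) \<in> F" using that by (auto simp: F_def)
    then have "\<gamma> \<le> norm (c k - b)" using F by (simp add: \<gamma>_def)
    then show False using that by simp
  qed
  define stop where "stop k \<longleftrightarrow> 1 \<le> k \<and> (norm (column_sums (sinkhorn_matrix a b K k) - b) < \<gamma> \<or> N \<le> k)" for k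
  define l where "l = sinkhorn_iterations a b K \<gamma> N"
  have l: "l = (LEAST k. stop k)" by (simp add: l_def sinkhorn_iterations_def stop_def)
  have "stop N" using N by (simp add: stop_def)
  then have "stop l" "l \<le> N" unfolding l by (rule LeastI, rule Least_le)
  then obtain k where k: "l = Suc k" by (cases l) (auto simp: stop_def)
  then have "norm (c k - b) < \<gamma> \<or> k = N - 1" using \<open>stop l\<close> \<open>l \<le> N\<close> by (auto simp: stop_def c_def)
  then have "hilbert_dist (c k) b \<le> s"
  proof
    assume "norm (c k - b) < \<gamma>"
    then have "c k = b" using small k \<open>l \<le> N\<close> by simp
    then show ?thesis using s b_pos by (simp add: hilbert_dist_self)
  next
    assume "k = N - 1"
    then show ?thesis using d by simp
  qed
  then show ?thesis using that[of \<gamma> k] \<gamma> k l_def \<open>l \<le> N\<close> by simp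
qed

theorem exists_sinkhorn_approximation:
  assumes "\<epsilon> > 0" "\<delta> > 0" "K = gibbs_kernel \<epsilon> C"
  shows "\<exists>\<gamma> k_max. \<gamma> > 0 \<and> k_max \<ge> 1 \<and>
    oracle_approximation (exp \<delta> - 1) (\<chi> i j. Q i j) (sinkhorn_output a b K \<gamma> k_max) \<and>
    int (sinkhorn_iterations a b K \<gamma> k_max) \<le> max 1 \<lceil>k_tilde a b C \<epsilon> \<delta>\<rceil>"
proof -
  \<comment> \<open>The iteration limit is the claimed bound itself. Iteration \<open>N\<close> has
    index \<open>N - 1\<close>, and \<open>N \<ge> 1\<close> makes this subtraction exact.\<close>
  define N where "N = nat (max 1 \<lceil>k_tilde a b C \<epsilon> \<delta>\<rceil>)"
  have N: "N \<ge> 1" "int N = max 1 \<lceil>k_tilde a b C \<epsilon> \<delta>\<rceil>" by (auto simp: N_def)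
  have "k_tilde a b C \<epsilon> \<delta> \<le> real_of_int (int N)" unfolding N(2) by linarith
  then have "hilbert_dist (c (N - 1)) b \<le> \<delta> * (1 - \<Lambda>)"
    using N(1) by (intro hilbert_dist_c_le_if_k_tilde_le[OF assms]) simp
  then obtain \<gamma> k where "\<gamma> > 0" and k: "sinkhorn_iterations a b K \<gamma> N = Suc k" "Suc k \<le> N"
      "hilbert_dist (c k) b \<le> \<delta> * (1 - \<Lambda>)"
    using exists_threshold[OF N(1)] assms(2) lambda_less_1 by (metis diff_ge_0_iff_ge less_imp_le mult_nonneg_nonneg)
  moreover have "oracle_approximation (exp \<delta> - 1) (\<chi> i j. Q i j) (sinkhorn_output a b K \<gamma> N)"
    unfolding oracle_approximation_def entry_max_norm_less_iff sinkhorn_output_def k(1)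
    using abs_P_minus_Q_less[OF k(3) assms(2)] by (simp add: sinkhorn_matrix_Suc)
  ultimately show ?thesis using N by (intro exI[of _ \<gamma>] exI[of _ N]) auto
qed

end

section \<open>The optimal coupling of finitely supported measures\<close>

text \<open>Up to a null set, \<open>f\<close> is a finite combination of indicators of singletons.
  This turns integrals against a coupling, a priori an arbitrary measure, into matrix sums.\<close>

lemma
  fixes f :: "'a \<Rightarrow> real"
  assumes M: "finite_measure M" and G: "finite G" "\<And>z. z \<in> G \<Longrightarrow> {z} \<in> sets M"
    and AE: "AE z in M. z \<in> G" and f: "f \<in> borel_measurable M"
  shows integrable_AE_in_finite: "integrable M f"
    and integral_AE_in_finite: "integral\<^sup>L M f = (\<Sum>z\<in>G. measure M {z} * f z)"
proof -
  interpret finite_measure M by (rule M)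
  define g where "g z = (\<Sum>w\<in>G. indicator {w} z * f w)" for z
  have eq: "AE z in M. f z = g z"
    using AE
  proof eventually_elim
    case (elim z)
    have "g z = (\<Sum>w\<in>G. if w = z then f z else 0)"
      unfolding g_def by (intro sum.cong) (auto simp: indicator_def)
    then show ?case using elim G by simp
  qed
  have int: "integrable M (\<lambda>z. indicator {w} z * f w)" if "w \<in> G" for w
    using G(2)[OF that] by (intro integrable_mult_left integrable_real_indicator) (auto simp: emeasure_eq_measure)
  have g: "integrable M g" "integral\<^sup>L M g = (\<Sum>z\<in>G. measure M {z} * f z)"
    unfolding g_def using int G(2) by (auto simp: Bochner_Integration.integral_sum intro!: sum.cong)
  show "integrable M f"
    using eq f g(1) integrable_cong_AE[of f M g] by auto
  show "integral\<^sup>L M f = (\<Sum>z\<in>G. measure M {z} * f z)"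
    using integral_cong_AE[of f M g] eq f g by auto
qed

lemma sets_weighted_diracs [simp]: "sets (weighted_diracs a x) = sets borel"
  by (simp add: weighted_diracs_def)

lemma space_weighted_diracs [simp]: "space (weighted_diracs a x) = UNIV"
  by (simp add: weighted_diracs_def)

lemma sum_eq_1_if_prob_space_weighted_diracs:
  assumes "prob_space (weighted_diracs a x)" "\<And>i. a $ i \<ge> 0"
  shows "(\<Sum>i\<in>UNIV. a $ i) = 1"
proof -
  have "ennreal (\<Sum>i\<in>UNIV. a $ i) = emeasure (weighted_diracs a x) UNIV"
    using assms(2) by (subst emeasure_weighted_diracs) auto
  also have "\<dots> = 1" using prob_space.emeasure_space_1[OF assms(1)] by simp
  finally show ?thesis using assms(2) by (simp add: sum_nonneg)
qed

section \<open>Couplings of two finitely supported measures\<close>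

locale discrete_marginals =
  fixes a :: "real ^ 'm" and b :: "real ^ 'n"
    and x :: "'m \<Rightarrow> 'a::{second_countable_topology, t2_space}"
    and y :: "'n \<Rightarrow> 'b::{second_countable_topology, t2_space}"
  assumes a_pos: "\<And>i. a $ i > 0" and b_pos: "\<And>j. b $ j > 0"
    and inj_x: "inj x" and inj_y: "inj y"
    and prob0: "prob_space (weighted_diracs a x)" and prob1: "prob_space (weighted_diracs b y)"
begin

abbreviation "\<mu> \<equiv> weighted_diracs a x"
abbreviation "\<nu> \<equiv> weighted_diracs b y"
abbreviation "G \<equiv> range x \<times> range y"

lemma finite_G: "finite G" by simp

lemma singleton_sets: "{z} \<in> sets (borel \<Otimes>\<^sub>M borel :: ('a \<times> 'b) measure)"
  by (metis borel_prod borel_singleton sets.empty_sets)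

lemma sum_G: "(\<Sum>z\<in>G. f z) = (\<Sum>i\<in>UNIV. \<Sum>j\<in>UNIV. f (x i, y j))"
proof -
  have "(\<Sum>z\<in>G. f z) = (\<Sum>r\<in>range x. \<Sum>t\<in>range y. f (r, t))"
    by (simp add: sum.cartesian_product)
  then show ?thesis using inj_x inj_y by (simp add: sum.reindex)
qed

lemma emeasure_\<mu>: "emeasure \<mu> {x i} = ennreal (a $ i)"
proof -
  have "emeasure \<mu> {x i} = (\<Sum>k\<in>UNIV. if k = i then ennreal (a $ i) else 0)"
    using inj_x by (subst emeasure_weighted_diracs) (auto simp: indicator_def inj_eq intro!: sum.cong)
  then show ?thesis by simp
qed

lemma emeasure_\<nu>: "emeasure \<nu> {y j} = ennreal (b $ j)"
proof -
  have "emeasure \<nu> {y j} = (\<Sum>k\<in>UNIV. if k = j then ennreal (b $ j) else 0)"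
    using inj_y by (subst emeasure_weighted_diracs) (auto simp: indicator_def inj_eq intro!: sum.cong)
  then show ?thesis by simp
qed

lemma emeasure_product: "emeasure (\<mu> \<Otimes>\<^sub>M \<nu>) {(x i, y j)} = ennreal (a $ i * b $ j)"
proof -
  interpret N: prob_space \<nu> by (rule prob1)
  have "emeasure (\<mu> \<Otimes>\<^sub>M \<nu>) ({x i} \<times> {y j}) = emeasure \<mu> {x i} * emeasure \<nu> {y j}"
    by (rule N.emeasure_pair_measure_Times) auto
  then show ?thesis
    using a_pos[of i] b_pos[of j] by (simp add: emeasure_\<mu> emeasure_\<nu> ennreal_mult less_imp_le)
qed

context
  fixes \<pi> assumes \<pi>: "\<pi> \<in> couplings \<mu> \<nu>"
begin

lemma sets_\<pi>: "sets \<pi> = sets (borel \<Otimes>\<^sub>M borel)"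
  and fst_\<pi>: "distr \<pi> borel fst = \<mu>" and snd_\<pi>: "distr \<pi> borel snd = \<nu>"
  using \<pi> by (auto simp: couplings_def)

lemma space_\<pi>: "space \<pi> = UNIV"
  using sets_eq_imp_space_eq[OF sets_\<pi>] by (simp add: space_pair_measure)

lemma measurable_\<pi>: "fst \<in> measurable \<pi> borel" "snd \<in> measurable \<pi> borel"
  unfolding measurable_cong_sets[OF sets_\<pi> refl] by simp_all

lemma emeasure_fst_vimage: "A \<in> sets borel \<Longrightarrow> emeasure \<pi> (fst -` A) = emeasure \<mu> A"
  using emeasure_distr[OF measurable_\<pi>(1), of A] by (simp add: fst_\<pi> space_\<pi>)

lemma emeasure_snd_vimage: "A \<in> sets borel \<Longrightarrow> emeasure \<pi> (snd -` A) = emeasure \<nu> A"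
  using emeasure_distr[OF measurable_\<pi>(2), of A] by (simp add: snd_\<pi> space_\<pi>)

lemma prob_space_\<pi>: "prob_space \<pi>"
  using emeasure_fst_vimage[of UNIV] prob_space.emeasure_space_1[OF prob0]
  by (intro prob_spaceI) (simp add: space_\<pi>)

text \<open>Each marginal gives no mass to the complement of its atoms, so the preimages of these
  complements under the projections are null for the coupling.\<close>

lemma AE_in_G: "AE z in \<pi>. z \<in> G"
proof -
  have borel: "- range x \<in> sets borel" "- range y \<in> sets borel"
    by (auto intro!: borel_open simp: open_Compl finite_imp_closed)
  have "emeasure \<mu> (- range x) = 0" "emeasure \<nu> (- range y) = 0"
    by (subst emeasure_weighted_diracs; use borel in simp)+
  then have "fst -` (- range x) \<in> null_sets \<pi>" "snd -` (- range y) \<in> null_sets \<pi>"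
    using measurable_sets[OF measurable_\<pi>(1) borel(1)] measurable_sets[OF measurable_\<pi>(2) borel(2)]
    by (auto simp: emeasure_fst_vimage emeasure_snd_vimage borel space_\<pi> intro!: null_setsI)
  then have "AE z in \<pi>. z \<notin> fst -` (- range x)" "AE z in \<pi>. z \<notin> snd -` (- range y)"
    by (simp_all only: AE_not_in)
  then show ?thesis by eventually_elim auto
qed

lemma
  fixes f :: "'a \<times> 'b \<Rightarrow> real"
  assumes "f \<in> borel_measurable \<pi>"
  shows integrable_\<pi>: "integrable \<pi> f"
    and integral_\<pi>: "integral\<^sup>L \<pi> f = (\<Sum>i\<in>UNIV. \<Sum>j\<in>UNIV. measure \<pi> {(x i, y j)} * f (x i, y j))"
  using integrable_AE_in_finite[OF _ finite_G _ AE_in_G assms]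
    integral_AE_in_finite[OF _ finite_G _ AE_in_G assms]
    prob_space.finite_measure[OF prob_space_\<pi>] singleton_sets
  by (simp_all only: sum_G sets_\<pi>)

lemma measure_\<pi>:
  assumes "E \<in> sets \<pi>"
  shows "measure \<pi> E = (\<Sum>i\<in>UNIV. \<Sum>j\<in>UNIV. measure \<pi> {(x i, y j)} * indicator E (x i, y j))"
  using integral_\<pi>[of "indicator E"] assms by (simp add: space_\<pi>)

lemma \<pi>_rows: "(\<Sum>j\<in>UNIV. measure \<pi> {(x i, y j)}) = a $ i"
proof -
  have "fst -` {x i} \<in> sets \<pi>"
    using measurable_sets[OF measurable_\<pi>(1), of "{x i}"] by (simp add: space_\<pi>)
  then have "measure \<pi> (fst -` {x i}) = (\<Sum>k\<in>UNIV. \<Sum>j\<in>UNIV. measure \<pi> {(x k, y j)} * indicator (fst -` {x i}) (x k, y j))"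
    by (rule measure_\<pi>)
  also have "\<dots> = (\<Sum>k\<in>UNIV. if k = i then \<Sum>j\<in>UNIV. measure \<pi> {(x k, y j)} else 0)"
    using inj_x by (intro sum.cong) (auto simp: indicator_def inj_eq)
  also have "\<dots> = (\<Sum>j\<in>UNIV. measure \<pi> {(x i, y j)})" by simp
  finally show ?thesis
    using emeasure_fst_vimage[of "{x i}"] a_pos[of i] by (simp add: measure_def emeasure_\<mu>)
qed

lemma \<pi>_columns: "(\<Sum>i\<in>UNIV. measure \<pi> {(x i, y j)}) = b $ j"
proof -
  have "snd -` {y j} \<in> sets \<pi>"
    using measurable_sets[OF measurable_\<pi>(2), of "{y j}"] by (simp add: space_\<pi>)
  then have "measure \<pi> (snd -` {y j}) = (\<Sum>i\<in>UNIV. \<Sum>k\<in>UNIV. measure \<pi> {(x i, y k)} * indicator (snd -` {y j}) (x i, y k))"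
    by (rule measure_\<pi>)
  also have "\<dots> = (\<Sum>i\<in>UNIV. \<Sum>k\<in>UNIV. if k = j then measure \<pi> {(x i, y j)} else 0)"
    using inj_y by (intro sum.cong) (auto simp: indicator_def inj_eq)
  also have "\<dots> = (\<Sum>i\<in>UNIV. measure \<pi> {(x i, y j)})" by simp
  finally show ?thesis
    using emeasure_snd_vimage[of "{y j}"] b_pos[of j] by (simp add: measure_def emeasure_\<nu>)
qed

text \<open>A null set of the product contains no grid point, because every
  \<open>a $ i * b $ j\<close> is positive, and the coupling lives on the grid.\<close>

lemma absolutely_continuous_\<pi>: "absolutely_continuous (\<mu> \<Otimes>\<^sub>M \<nu>) \<pi>"
  unfolding absolutely_continuous_def
proof
  fix N assume N: "N \<in> null_sets (\<mu> \<Otimes>\<^sub>M \<nu>)"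
  have "(x i, y j) \<notin> N" for i j
  proof
    assume "(x i, y j) \<in> N"
    then have "emeasure (\<mu> \<Otimes>\<^sub>M \<nu>) {(x i, y j)} \<le> emeasure (\<mu> \<Otimes>\<^sub>M \<nu>) N"
      using N by (intro emeasure_mono) auto
    then show False
      using N a_pos[of i] b_pos[of j] by (simp add: emeasure_product null_setsD1 mult_le_0_iff)
  qed
  moreover have "N \<in> sets \<pi>"
    using N by (auto simp: sets_\<pi> null_sets_def cong: sets_pair_measure_cong)
  ultimately have "measure \<pi> N = 0"
    by (subst measure_\<pi>) auto
  then show "N \<in> null_sets \<pi>"
    using \<open>N \<in> sets \<pi>\<close> finite_measure.emeasure_eq_measure[OF prob_space.finite_measure[OF prob_space_\<pi>]]
    by (simp add: null_sets_def)
qed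

text \<open>In general the derivative is determined only almost everywhere; at an atom of positive
  product mass, integrating over the singleton fixes its value.\<close>

lemma RN_deriv_\<pi>:
  "enn2real (RN_deriv (\<mu> \<Otimes>\<^sub>M \<nu>) \<pi> (x i, y j)) = measure \<pi> {(x i, y j)} / (a $ i * b $ j)"
proof -
  interpret pair_prob_space \<mu> \<nu>
    unfolding pair_prob_space_def pair_sigma_finite_def
    using prob0 prob1 by (simp add: prob_space_imp_sigma_finite)
  have sets: "sets \<pi> = sets (\<mu> \<Otimes>\<^sub>M \<nu>)"
    by (simp add: sets_\<pi> cong: sets_pair_measure_cong)
  have s: "{(x i, y j)} \<in> sets (\<mu> \<Otimes>\<^sub>M \<nu>)" unfolding sets[symmetric] sets_\<pi> by (rule singleton_sets)
  have "emeasure \<pi> {(x i, y j)} = emeasure (density (\<mu> \<Otimes>\<^sub>M \<nu>) (RN_deriv (\<mu> \<Otimes>\<^sub>M \<nu>) \<pi>)) {(x i, y j)}"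
    by (simp add: density_RN_deriv[OF absolutely_continuous_\<pi> sets])
  also have "\<dots> = RN_deriv (\<mu> \<Otimes>\<^sub>M \<nu>) \<pi> (x i, y j) * ennreal (a $ i * b $ j)"
    using s by (simp add: emeasure_density emeasure_product)
  finally have "measure \<pi> {(x i, y j)} = enn2real (RN_deriv (\<mu> \<Otimes>\<^sub>M \<nu>) \<pi> (x i, y j)) * (a $ i * b $ j)"
    using a_pos[of i] b_pos[of j] by (simp add: measure_def enn2real_mult)
  then show ?thesis using a_pos[of i] b_pos[of j] by (simp add: field_simps)
qed

text \<open>Absolute continuity and integrability hold for every coupling here, so the infinite
  value of \<open>rel_entropy\<close> does not occur.\<close>

lemma rel_entropy_\<pi>:
  "rel_entropy \<pi> (\<mu> \<Otimes>\<^sub>M \<nu>)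
    = ereal (\<Sum>i\<in>UNIV. \<Sum>j\<in>UNIV. measure \<pi> {(x i, y j)} * ln (measure \<pi> {(x i, y j)} / (a $ i * b $ j)))"
proof -
  have sets: "sets (\<mu> \<Otimes>\<^sub>M \<nu>) = sets \<pi>"
    by (simp add: sets_\<pi> cong: sets_pair_measure_cong)
  have m: "entropy_density (exp 1) (\<mu> \<Otimes>\<^sub>M \<nu>) \<pi> \<in> borel_measurable \<pi>"
    using measurable_entropy_density[of "exp 1" "\<mu> \<Otimes>\<^sub>M \<nu>" \<pi>] by (simp only: measurable_cong_sets[OF sets refl])
  show ?thesis
    using absolutely_continuous_\<pi> integrable_\<pi>[OF m]
    unfolding rel_entropy_def KL_divergence_def integral_\<pi>[OF m]
    by (simp add: entropy_density_def RN_deriv_\<pi> log_ln)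
qed

lemma eot_objective_\<pi>:
  assumes "cst \<in> borel_measurable (borel \<Otimes>\<^sub>M borel)"
  shows "eot_objective cst \<epsilon> \<mu> \<nu> \<pi> = ereal (\<Sum>i\<in>UNIV. \<Sum>j\<in>UNIV. measure \<pi> {(x i, y j)} * cst (x i, y j)
    + \<epsilon> * (measure \<pi> {(x i, y j)} * ln (measure \<pi> {(x i, y j)} / (a $ i * b $ j))))"
proof -
  have "cst \<in> borel_measurable \<pi>" using assms by (simp only: measurable_cong_sets[OF sets_\<pi> refl])
  then show ?thesis
    by (simp add: eot_objective_def rel_entropy_\<pi> integral_\<pi> sum.distrib sum_distrib_left)
qed

end

section \<open>From matrices back to couplings, and optimality\<close>

lemma coupling_eqI:
  assumes "\<pi> \<in> couplings \<mu> \<nu>" "\<pi>' \<in> couplings \<mu> \<nu>"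
    and "\<And>i j. measure \<pi> {(x i, y j)} = measure \<pi>' {(x i, y j)}"
  shows "\<pi> = \<pi>'"
proof (rule measure_eqI)
  show sets: "sets \<pi> = sets \<pi>'" using assms sets_\<pi> by simp
  fix E assume "E \<in> sets \<pi>"
  then have "measure \<pi> E = measure \<pi>' E" using assms sets by (simp add: measure_\<pi>)
  then show "emeasure \<pi> E = emeasure \<pi>' E"
    using prob_space_\<pi> assms(1,2) by (simp add: prob_space.finite_measure finite_measure.emeasure_eq_measure)
qed

text \<open>Encoding it as weighted Dirac measures indexed by pairs makes
  \<open>emeasure_weighted_diracs\<close> available.\<close>

definition grid_measure :: "('m \<Rightarrow> 'n \<Rightarrow> real) \<Rightarrow> ('a \<times> 'b) measure" where
  "grid_measure R = weighted_diracs (\<chi> p. R (fst p) (snd p)) (\<lambda>p. (x (fst p), y (snd p)))"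

lemma emeasure_grid_measure:
  assumes "E \<in> sets borel"
  shows "emeasure (grid_measure R) E = (\<Sum>i\<in>UNIV. \<Sum>j\<in>UNIV. ennreal (R i j) * indicator E (x i, y j))"
  unfolding grid_measure_def emeasure_weighted_diracs[OF assms]
  by (simp only: vec_lambda_beta sum.cartesian_product UNIV_Times_UNIV case_prod_unfold)

lemma measure_grid_measure:
  assumes "\<And>i j. R i j \<ge> 0"
  shows "measure (grid_measure R) {(x i, y j)} = R i j"
proof -
  have "emeasure (grid_measure R) {(x i, y j)}
      = (\<Sum>k\<in>UNIV. \<Sum>l\<in>UNIV. ennreal (R k l) * indicator {(x i, y j)} (x k, y l))"
    by (rule emeasure_grid_measure) simp
  also have "\<dots> = (\<Sum>k\<in>UNIV. if k = i then \<Sum>l\<in>UNIV. if l = j then ennreal (R i j) else 0 else 0)"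
  proof (rule sum.cong[OF refl])
    fix k
    have "ennreal (R k l) * indicator {(x i, y j)} (x k, y l) = (if k = i then if l = j then ennreal (R i j) else 0 else 0)" for l
      using inj_x inj_y by (auto simp: inj_eq)
    then show "(\<Sum>l\<in>UNIV. ennreal (R k l) * indicator {(x i, y j)} (x k, y l))
        = (if k = i then \<Sum>l\<in>UNIV. if l = j then ennreal (R i j) else 0 else 0)"
      by simp
  qed
  also have "\<dots> = ennreal (R i j)" by simp
  finally have "emeasure (grid_measure R) {(x i, y j)} = ennreal (R i j)" .
  then show ?thesis using assms by (simp add: measure_def)
qed

lemma grid_measure_coupling:
  assumes R: "\<And>i j. R i j \<ge> 0" and rows: "\<And>i. (\<Sum>j\<in>UNIV. R i j) = a $ i"
    and cols: "\<And>j. (\<Sum>i\<in>UNIV. R i j) = b $ j"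
  shows "grid_measure R \<in> couplings \<mu> \<nu>"
proof -
  have sets: "sets (grid_measure R) = sets (borel \<Otimes>\<^sub>M borel)"
    by (simp only: grid_measure_def sets_weighted_diracs borel_prod)
  have space: "space (grid_measure R) = UNIV" by (simp add: grid_measure_def)
  have meas: "fst \<in> measurable (grid_measure R) borel" "snd \<in> measurable (grid_measure R) borel"
    unfolding measurable_cong_sets[OF sets refl] by simp_all
  have vimage: "fst -` A \<in> sets (borel :: ('a \<times> 'b) measure)" "snd -` B \<in> sets (borel :: ('a \<times> 'b) measure)"
    if "A \<in> sets borel" "B \<in> sets borel" for A B
    using measurable_sets[OF meas(1) that(1)] measurable_sets[OF meas(2) that(2)]
    unfolding sets borel_prod by (simp_all add: space)
  have "distr (grid_measure R) borel fst = \<mu>"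
  proof (rule measure_eqI)
    fix A assume "A \<in> sets (distr (grid_measure R) borel fst)"
    then have A: "A \<in> sets borel" by simp
    have "emeasure (distr (grid_measure R) borel fst) A = (\<Sum>i\<in>UNIV. \<Sum>j\<in>UNIV. ennreal (R i j) * indicator A (x i))"
      using meas A vimage
      by (simp add: emeasure_distr space emeasure_grid_measure indicator_def)
    also have "\<dots> = (\<Sum>i\<in>UNIV. ennreal (a $ i) * indicator A (x i))"
      by (simp only: sum_distrib_right[symmetric] sum_ennreal[OF R] rows)
    finally show "emeasure (distr (grid_measure R) borel fst) A = emeasure \<mu> A"
      by (simp add: emeasure_weighted_diracs[OF A])
  qed simp
  moreover have "distr (grid_measure R) borel snd = \<nu>"
  proof (rule measure_eqI)
    fix B assume "B \<in> sets (distr (grid_measure R) borel snd)"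
    then have B: "B \<in> sets borel" by simp
    have "emeasure (distr (grid_measure R) borel snd) B = (\<Sum>i\<in>UNIV. \<Sum>j\<in>UNIV. ennreal (R i j) * indicator B (y j))"
      using meas B vimage by (simp add: emeasure_distr space emeasure_grid_measure indicator_def)
    also have "\<dots> = (\<Sum>j\<in>UNIV. ennreal (b $ j) * indicator B (y j))"
      by (subst sum.swap) (simp only: sum_distrib_right[symmetric] sum_ennreal[OF R] cols)
    finally show "emeasure (distr (grid_measure R) borel snd) B = emeasure \<nu> B"
      by (simp add: emeasure_weighted_diracs[OF B])
  qed simp
  ultimately show ?thesis using sets by (simp add: couplings_def)
qed

text \<open>
  For a matrix of the scaled form \<open>R\<close>, the objective equals, up to an additive constant,
  \<open>\<epsilon>\<close> times the relative entropy with respect to \<open>R\<close>.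
\<close>

lemma eot_plan_eq_grid_measure:
  assumes cst: "cst \<in> borel_measurable (borel \<Otimes>\<^sub>M borel)" and \<epsilon>: "\<epsilon> > 0"
    and us: "\<And>i. us $ i > 0" and vs: "\<And>j. vs $ j > 0"
    and R: "\<And>i j. R i j = us $ i * exp (- cst (x i, y j) / \<epsilon>) * vs $ j"
    and rows: "\<And>i. (\<Sum>j\<in>UNIV. R i j) = a $ i" and cols: "\<And>j. (\<Sum>i\<in>UNIV. R i j) = b $ j"
  shows "eot_plan cst \<epsilon> \<mu> \<nu> = grid_measure R"
proof -
  have Rpos: "R i j > 0" for i j using us vs by (simp add: R)
  \<comment> \<open>The constant \<open>\<kappa>\<close> is the same for all couplings: each
    logarithm depends on a single index and is summed against a prescribed marginal.\<close>
  define \<kappa> where "\<kappa> = (\<Sum>i\<in>UNIV. a $ i * ln (us $ i / a $ i)) + (\<Sum>j\<in>UNIV. b $ j * ln (vs $ j / b $ j))"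
  define KL where "KL \<pi> = kl (\<lambda>(i, j). measure \<pi> {(x i, y j)}) (\<lambda>(i, j). R i j)" for \<pi>
  have obj: "eot_objective cst \<epsilon> \<mu> \<nu> \<pi> = ereal (\<epsilon> * KL \<pi> + \<epsilon> * \<kappa>)" if \<pi>: "\<pi> \<in> couplings \<mu> \<nu>" for \<pi>
  proof -
    define q where "q i j = measure \<pi> {(x i, y j)}" for i j
    have q: "q i j \<ge> 0" for i j by (simp add: q_def)
    have split: "q i j * cst (x i, y j) + \<epsilon> * (q i j * ln (q i j / (a $ i * b $ j)))
        = \<epsilon> * (q i j * ln (q i j / R i j)) + (\<epsilon> * (q i j * ln (us $ i / a $ i)) + \<epsilon> * (q i j * ln (vs $ j / b $ j)))" for i j
    \<comment> \<open>At a zero entry both sides vanish; logarithms are expanded only where the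
      entry is positive.\<close>
    proof (cases "q i j = 0")
      case False
      then have qp: "q i j > 0" using q[of i j] by simp
      have "ln (R i j) = ln (us $ i) - cst (x i, y j) / \<epsilon> + ln (vs $ j)"
        using us[of i] vs[of j] by (simp add: R ln_mult_pos)
      then have cst_eq: "cst (x i, y j) = \<epsilon> * (ln (us $ i) + ln (vs $ j) - ln (R i j))"
        using \<epsilon> by (simp add: field_simps)
      show ?thesis
        unfolding cst_eq using qp Rpos[of i j] us[of i] vs[of j] a_pos[of i] b_pos[of j]
        by (simp add: ln_divide_pos ln_mult_pos algebra_simps)
    qed simp
    have "eot_objective cst \<epsilon> \<mu> \<nu> \<pi> = ereal (\<epsilon> * KL \<pi> +
        (\<epsilon> * (\<Sum>i\<in>UNIV. \<Sum>j\<in>UNIV. q i j * ln (us $ i / a $ i)) + \<epsilon> * (\<Sum>i\<in>UNIV. \<Sum>j\<in>UNIV. q i j * ln (vs $ j / b $ j))))"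
      unfolding eot_objective_\<pi>[OF \<pi> cst] KL_def kl_pair_eq q_def[symmetric] split
      by (simp only: sum.distrib sum_distrib_left)
    also have "(\<Sum>i\<in>UNIV. \<Sum>j\<in>UNIV. q i j * ln (us $ i / a $ i)) = (\<Sum>i\<in>UNIV. a $ i * ln (us $ i / a $ i))"
      by (simp add: sum_distrib_right[symmetric] q_def \<pi>_rows[OF \<pi>])
    also have "(\<Sum>i\<in>UNIV. \<Sum>j\<in>UNIV. q i j * ln (vs $ j / b $ j)) = (\<Sum>j\<in>UNIV. b $ j * ln (vs $ j / b $ j))"
      by (subst sum.swap) (simp add: sum_distrib_right[symmetric] q_def \<pi>_columns[OF \<pi>])
    finally show ?thesis by (simp add: \<kappa>_def distrib_left)
  qed
  have mass: "sum (\<lambda>(i, j). measure \<pi> {(x i, y j)}) UNIV = sum (\<lambda>(i, j). R i j) UNIV" if "\<pi> \<in> couplings \<mu> \<nu>" for \<pi>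
    using \<pi>_rows[OF that] by (simp add: sum_pair_UNIV rows)
  have KL_nonneg: "KL \<pi> \<ge> 0" if "\<pi> \<in> couplings \<mu> \<nu>" for \<pi>
    unfolding KL_def
    by (rule kl_nonneg[OF _ _ mass[OF that]]) (simp_all add: case_prod_beta Rpos)
  have KL_0: "measure \<pi> {(x i, y j)} = R i j" if "\<pi> \<in> couplings \<mu> \<nu>" "KL \<pi> \<le> 0" for \<pi> i j
  proof -
    have "(\<lambda>(i, j). measure \<pi> {(x i, y j)}) = (\<lambda>(i, j). R i j)"
      by (rule kl_le_0_imp_eq[OF _ _ mass[OF that(1)]])
        (use that(2) in \<open>simp_all add: case_prod_beta Rpos KL_def\<close>)
    from fun_cong[OF this, of "(i, j)"] show ?thesis by simp
  qed
  let ?\<pi> = "grid_measure R"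
  have c: "?\<pi> \<in> couplings \<mu> \<nu>" using Rpos rows cols by (intro grid_measure_coupling) (auto intro: less_imp_le)
  have m: "measure ?\<pi> {(x i, y j)} = R i j" for i j
    using Rpos by (intro measure_grid_measure) (auto intro: less_imp_le)
  have KL: "KL ?\<pi> = 0" using Rpos by (simp add: KL_def kl_pair_eq m less_imp_neq[symmetric])
  have val: "eot_value cst \<epsilon> \<mu> \<nu> = ereal (\<epsilon> * \<kappa>)"
    unfolding eot_value_def
  proof (rule antisym)
    show "(INF \<pi>\<in>couplings \<mu> \<nu>. eot_objective cst \<epsilon> \<mu> \<nu> \<pi>) \<le> ereal (\<epsilon> * \<kappa>)"
      using c by (intro INF_lower2[of ?\<pi>]) (auto simp: obj KL)
    show "ereal (\<epsilon> * \<kappa>) \<le> (INF \<pi>\<in>couplings \<mu> \<nu>. eot_objective cst \<epsilon> \<mu> \<nu> \<pi>)"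
      using KL_nonneg \<epsilon> by (intro INF_greatest) (auto simp: obj)
  qed
  show ?thesis
    unfolding eot_plan_def
  proof (rule the_equality)
    show "eot_optimal cst \<epsilon> \<mu> \<nu> ?\<pi>" by (simp add: eot_optimal_def c val obj KL)
    \<comment> \<open>Another optimum has relative entropy 0 with respect to \<open>R\<close>, hence
      the same matrix, and a coupling is determined by its matrix.\<close>
    fix \<pi> assume "eot_optimal cst \<epsilon> \<mu> \<nu> \<pi>"
    then have \<pi>: "\<pi> \<in> couplings \<mu> \<nu>" and "\<epsilon> * KL \<pi> + \<epsilon> * \<kappa> = \<epsilon> * \<kappa>"
      by (auto simp: eot_optimal_def val obj)
    then have "KL \<pi> \<le> 0" using \<epsilon> by simp
    then show "\<pi> = ?\<pi>" using KL_0[OF \<pi>] m c \<pi> by (intro coupling_eqI) auto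
  qed
qed

end

text \<open>The scaled matrix \<open>Q\<close> has the prescribed marginals and the Gibbs form of
  the cost, so \<open>eot_plan_eq_grid_measure\<close> identifies it with \<open>\<Pi>A\<close>, and
  \<open>exists_sinkhorn_approximation\<close> applies.\<close>

theorem proposition8:
  fixes a :: "real ^ 'n0" and b :: "real ^ 'n1"
    and x :: "'n0 \<Rightarrow> real ^ 'd0" and y :: "'n1 \<Rightarrow> real ^ 'd1"
    and \<mu>0 :: "(real ^ 'd0) measure" and \<mu>1 :: "(real ^ 'd1) measure"
    and A :: "real ^ 'd1 ^ 'd0" and \<epsilon> \<delta> :: real
    and \<Pi>A C K :: "real ^ 'n1 ^ 'n0"
  assumes "\<mu>0 = weighted_diracs a x" and "\<mu>1 = weighted_diracs b y"
    and "prob_space \<mu>0" and "prob_space \<mu>1"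
    and "inj x" and "inj y"
    and "\<forall>i. a $ i > 0" and "\<forall>j. b $ j > 0"
    and "\<epsilon> > 0" and "\<delta> > 0"
    and "\<Pi>A = plan_matrix x y (eot_plan (cost_A A) \<epsilon> \<mu>0 \<mu>1)"
    and "C = cost_matrix (cost_A A) x y"
    and "K = gibbs_kernel \<epsilon> C"
  shows "\<exists>\<gamma> k_max. \<gamma> > 0 \<and> k_max \<ge> 1 \<and>
    oracle_approximation (exp \<delta> - 1) \<Pi>A (sinkhorn_output a b K \<gamma> k_max) \<and>
    int (sinkhorn_iterations a b K \<gamma> k_max) \<le> max 1 \<lceil>k_tilde a b C \<epsilon> \<delta>\<rceil>"
proof -
  note prob = assms(3)[unfolded assms(1)] assms(4)[unfolded assms(2)]
  interpret marginals: discrete_marginals a b x y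
    using assms(5-8) prob by (intro discrete_marginals.intro) simp_all
  have "(\<Sum>i\<in>UNIV. a $ i) = 1" "(\<Sum>j\<in>UNIV. b $ j) = 1"
    using sum_eq_1_if_prob_space_weighted_diracs[OF prob(1)] sum_eq_1_if_prob_space_weighted_diracs[OF prob(2)]
      assms(7,8) by (simp_all add: less_imp_le)
  then interpret sinkhorn a b K
    using assms(7,8) by unfold_locales (auto simp: assms(13) gibbs_kernel_pos)
  obtain us vs where "sinkhorn_scaling a b K us vs" by (rule exists_scaling)
  then interpret sinkhorn_scaling a b K us vs .
  have "cost_A A \<in> borel_measurable (borel \<Otimes>\<^sub>M borel)"
  proof -
    have "continuous_on UNIV (cost_A A)"
      unfolding cost_A_def case_prod_beta
      by (intro continuous_intros linear_continuous_on_compose[OF _ matrix_vector_mul_linear])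
    then show ?thesis by (simp add: borel_prod borel_measurable_continuous_onI)
  qed
  moreover have "Q i j = us $ i * exp (- cost_A A (x i, y j) / \<epsilon>) * vs $ j" for i j
    unfolding Q_def by (simp add: assms(12,13) gibbs_kernel_def cost_matrix_def)
  ultimately have "eot_plan (cost_A A) \<epsilon> \<mu>0 \<mu>1 = marginals.grid_measure Q"
    unfolding assms(1,2)
    by (rule marginals.eot_plan_eq_grid_measure[OF _ assms(9) us_pos vs_pos _ Q_rows Q_columns])
  then have "\<Pi>A = (\<chi> i j. Q i j)"
    unfolding assms(11) plan_matrix_def
    by (simp only: marginals.measure_grid_measure[of Q, OF less_imp_le[OF Q_pos]])
  then show ?thesis using exists_sinkhorn_approximation[OF assms(9,10,13)] by (simp only:)
qed

end
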